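(* Let $R$ be an integral domain and let $k\subset R$ be a field of positive characteristic $p$. Suppose that $R^p$ and $k$ are not linearly disjoint over $k^p$, that the module of Kähler differentials $\Omega_{R/k}$ is of finite presentation over $R$, and that $Q(R)$, the quotient field of $R$, is a finitely generated extension field of $k$. Then $\mathrm{IDer}_k(R)\subsetneq\mathrm{Der}_k(R)$.
   Context: Rings are commutative with unit. $R^p=\{r^p\mid r\in R\}$ and $k^p=\{c^p\mid c\in k\}$. Linear disjointness: if $K$ is a field and $K\subset S_1,S_2\subset\Omega$ are ring extensions, $S_1$ and $S_2$ are linearly disjoint over $K$ if the canonical map $S_1\otimes_K S_2\to\Omega$ is injective. Here $K=k^p$, $S_1=R^p$, $S_2=k$, $\Omega=R$. Integrable derivations: an HS-derivation of $R$ over $k$ of length $\infty$ is a sequence $D=(D_0,D_1,D_2,\ldots)$ of $k$-linear maps $D_\alpha:R\to R$ with $D_0=\mathrm{Id}_R$ and $D_\alpha(xy)=\sum_{i+j=\alpha}D_i(x)D_j(y)$ for all $x,y\in R$ and all $\alpha$. $\mathrm{Der}_k(R)$ is the module of $k$-derivations $R\to R$, and $\mathrm{IDer}_k(R)$ is the set of $\delta\in\mathrm{Der}_k(R)$ for which there is an HS-derivation $D$ of $R$ over $k$ of length $\infty$ with $D_1=\delta$. *)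

theory Defs
  imports Complex_Main "HOL-Library.Poly_Mapping" "HOL-Computational_Algebra.Fraction_Field"
begin

section \<open>Free modules and quotient modules\<close>

text \<open>
  The free module with basis (indexed by) a type \<open>'b\<close> over a ring \<open>'a\<close> is the type \<open>'b \<Rightarrow>\<^sub>0 'a\<close> of
  finitely supported functions, with basis elements \<open>Poly_Mapping.single b 1\<close>. The multiplication
  that \<open>Poly_Mapping\<close> puts on this type plays no role here.
\<close>

definition fscale :: "'a::comm_ring_1 \<Rightarrow> ('b \<Rightarrow>\<^sub>0 'a) \<Rightarrow> ('b \<Rightarrow>\<^sub>0 'a)" where
  "fscale a f = Poly_Mapping.map ((*) a) f"

lemma lookup_fscale [simp]: "Poly_Mapping.lookup (fscale a f) b = a * Poly_Mapping.lookup f b"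
  by (simp add: fscale_def Poly_Mapping.map.rep_eq when_def)

interpretation free: module fscale
  by standard (auto intro!: poly_mapping_eqI simp: lookup_add algebra_simps)

definition free_on :: "'b set \<Rightarrow> ('b \<Rightarrow>\<^sub>0 'a::comm_ring_1) set" where
  "free_on S = {f. Poly_Mapping.keys f \<subseteq> S}"

text \<open>Congruence modulo a subgroup \<open>N\<close>; its classes are the cosets of \<open>N\<close>, so that \<open>M / N\<close> is
  \<open>M // cong_mod N\<close>, and the class of \<open>x\<close> is \<open>cong_mod N `` {x}\<close>.\<close>

definition cong_mod :: "'m::ab_group_add set \<Rightarrow> ('m \<times> 'm) set" where
  "cong_mod N = {(x, y). x - y \<in> N}"

definition quot_add :: "'m::ab_group_add set \<Rightarrow> 'm set \<Rightarrow> 'm set \<Rightarrow> 'm set" where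
  "quot_add N X Y = cong_mod N `` {x + y |x y. x \<in> X \<and> y \<in> Y}"

definition quot_scale ::
    "('a \<Rightarrow> 'm \<Rightarrow> 'm) \<Rightarrow> 'm::ab_group_add set \<Rightarrow> 'a \<Rightarrow> 'm set \<Rightarrow> 'm set" where
  "quot_scale scale N a X = cong_mod N `` (scale a ` X)"

lemma (in module) equiv_cong_mod:
  assumes "subspace N"
  shows "equiv UNIV (cong_mod N)"
proof (rule equivI)
  show "refl (cong_mod N)"
    using assms by (auto simp: refl_on_def cong_mod_def subspace_0)
  show "sym (cong_mod N)"
  proof (rule symI)
    fix x y assume "(x, y) \<in> cong_mod N"
    hence "- (x - y) \<in> N" using assms unfolding cong_mod_def by (blast intro: subspace_neg)
    thus "(y, x) \<in> cong_mod N" by (simp add: cong_mod_def)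
  qed
  show "trans (cong_mod N)"
  proof (rule transI)
    fix x y z assume "(x, y) \<in> cong_mod N" "(y, z) \<in> cong_mod N"
    hence "(x - y) + (y - z) \<in> N" using assms unfolding cong_mod_def by (blast intro: subspace_add)
    thus "(x, z) \<in> cong_mod N" by (simp add: cong_mod_def)
  qed
qed auto

lemma (in module) quot_add_class:
  assumes "subspace N"
  shows "quot_add N (cong_mod N `` {x}) (cong_mod N `` {y}) = cong_mod N `` {x + y}"
proof -
  have "(x + y, z) \<in> cong_mod N"
    if "(x, x') \<in> cong_mod N" "(y, y') \<in> cong_mod N" "(x' + y', z) \<in> cong_mod N" for x' y' z
  proof -
    have "(x - x') + (y - y') + (x' + y' - z) \<in> N"
      using that assms unfolding cong_mod_def by (blast intro: subspace_add)
    thus ?thesis by (simp add: cong_mod_def algebra_simps)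
  qed
  moreover have "(x, x) \<in> cong_mod N" for x
    using assms by (simp add: cong_mod_def subspace_0)
  ultimately show ?thesis unfolding quot_add_def by blast
qed

lemma (in module) quot_scale_class:
  assumes "subspace N"
  shows "quot_scale scale N a (cong_mod N `` {x}) = cong_mod N `` {scale a x}"
proof -
  have "(scale a x, z) \<in> cong_mod N"
    if "(x, x') \<in> cong_mod N" "(scale a x', z) \<in> cong_mod N" for x' z
  proof -
    have "scale a (x - x') + (scale a x' - z) \<in> N"
      using that assms unfolding cong_mod_def by (blast intro: subspace_add subspace_scale)
    thus ?thesis by (simp add: cong_mod_def algebra_simps)
  qed
  moreover have "(x, x) \<in> cong_mod N" for x
    using assms by (simp add: cong_mod_def subspace_0)
  ultimately show ?thesis unfolding quot_scale_def by blast
qed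

text \<open>
  A module with carrier \<open>M\<close>, addition \<open>add\<close>, zero element \<open>zero\<close> and scalar multiplication \<open>scale\<close>
  is of finite presentation if it is the image of a linear map from some \<open>R\<^sup>n\<close> whose kernel is a
  finitely generated submodule. Here \<open>R\<^sup>n\<close> is \<open>free_on {..<n}\<close>.
\<close>

definition finitely_presented ::
    "'m set \<Rightarrow> ('m \<Rightarrow> 'm \<Rightarrow> 'm) \<Rightarrow> 'm \<Rightarrow> ('a::comm_ring_1 \<Rightarrow> 'm \<Rightarrow> 'm) \<Rightarrow> bool" where
  "finitely_presented M add zero scale \<longleftrightarrow>
     (\<exists>(n::nat) \<phi>.
        (\<forall>x\<in>free_on {..<n}. \<forall>y\<in>free_on {..<n}. \<phi> (x + y) = add (\<phi> x) (\<phi> y)) \<and>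
        (\<forall>a. \<forall>x\<in>free_on {..<n}. \<phi> (fscale a x) = scale a (\<phi> x)) \<and>
        \<phi> ` free_on {..<n} = M \<and>
        (\<exists>G. finite G \<and> free.span G = {x \<in> free_on {..<n}. \<phi> x = zero}))"


section \<open>Subfields\<close>

definition is_subfield :: "'a::comm_ring_1 set \<Rightarrow> bool" where
  "is_subfield K \<longleftrightarrow>
     0 \<in> K \<and> 1 \<in> K \<and> (0::'a) \<noteq> 1 \<and>
     (\<forall>x\<in>K. \<forall>y\<in>K. x + y \<in> K) \<and> (\<forall>x\<in>K. - x \<in> K) \<and> (\<forall>x\<in>K. \<forall>y\<in>K. x * y \<in> K) \<and>
     (\<forall>x\<in>K. x \<noteq> 0 \<longrightarrow> (\<exists>y\<in>K. x * y = 1))"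

definition field_generated :: "'a::field set \<Rightarrow> 'a set" where
  "field_generated S = \<Inter>{L. is_subfield L \<and> S \<subseteq> L}"

text \<open>The quotient field of the domain \<open>'a\<close> is the type \<open>'a fract\<close>, which contains \<open>'a\<close> via
  \<open>r \<mapsto> r/1\<close>.\<close>

definition fraction_field_finitely_generated :: "'a::idom set \<Rightarrow> bool" where
  "fraction_field_finitely_generated k \<longleftrightarrow>
     (\<exists>S :: 'a fract set. finite S \<and> field_generated ((\<lambda>c. Fract c 1) ` k \<union> S) = UNIV)"


section \<open>Tensor products and linear disjointness\<close>

text \<open>
  For subrings \<open>S\<^sub>1\<close>, \<open>S\<^sub>2\<close> of \<open>'a\<close> containing \<open>K\<close>, the tensor product over \<open>K\<close> is the free abelian
  group on \<open>S\<^sub>1 \<times> S\<^sub>2\<close> modulo the subgroup generated by the usual bilinearity relations.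
\<close>

abbreviation pure_tensor :: "'a \<Rightarrow> 'a \<Rightarrow> ('a \<times> 'a) \<Rightarrow>\<^sub>0 int" where
  "pure_tensor x y \<equiv> Poly_Mapping.single (x, y) 1"

definition tensor_relations ::
    "'a::comm_ring_1 set \<Rightarrow> 'a set \<Rightarrow> 'a set \<Rightarrow> (('a \<times> 'a) \<Rightarrow>\<^sub>0 int) set" where
  "tensor_relations K S1 S2 = free.span (
     {pure_tensor (x + x') y - pure_tensor x y - pure_tensor x' y |x x' y.
        x \<in> S1 \<and> x' \<in> S1 \<and> y \<in> S2} \<union>
     {pure_tensor x (y + y') - pure_tensor x y - pure_tensor x y' |x y y'.
        x \<in> S1 \<and> y \<in> S2 \<and> y' \<in> S2} \<union>
     {pure_tensor (x * c) y - pure_tensor x (c * y) |x c y.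
        x \<in> S1 \<and> c \<in> K \<and> y \<in> S2})"

definition tensor_product ::
    "'a::comm_ring_1 set \<Rightarrow> 'a set \<Rightarrow> 'a set \<Rightarrow> (('a \<times> 'a) \<Rightarrow>\<^sub>0 int) set set" where
  "tensor_product K S1 S2 = free_on (S1 \<times> S2) // cong_mod (tensor_relations K S1 S2)"

definition tensor_eval :: "(('a::comm_ring_1 \<times> 'a) \<Rightarrow>\<^sub>0 int) \<Rightarrow> 'a" where
  "tensor_eval f = (\<Sum>(x, y)\<in>Poly_Mapping.keys f. of_int (Poly_Mapping.lookup f (x, y)) * (x * y))"

text \<open>The canonical map \<open>x \<otimes> y \<mapsto> x * y\<close>: evaluation is constant on each class, and the value on a
  class is the common value of its elements.\<close>

definition tensor_mult :: "(('a::comm_ring_1 \<times> 'a) \<Rightarrow>\<^sub>0 int) set \<Rightarrow> 'a" where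
  "tensor_mult X = the_elem (tensor_eval ` X)"

definition linearly_disjoint :: "'a::comm_ring_1 set \<Rightarrow> 'a set \<Rightarrow> 'a set \<Rightarrow> bool" where
  "linearly_disjoint K S1 S2 \<longleftrightarrow> inj_on tensor_mult (tensor_product K S1 S2)"

lemma tensor_eval_superset:
  assumes "finite A" "Poly_Mapping.keys f \<subseteq> A"
  shows "tensor_eval f = (\<Sum>t\<in>A. of_int (Poly_Mapping.lookup f t) * (fst t * snd t))"
  unfolding tensor_eval_def split_def
  by (rule sum.mono_neutral_cong_left) (use assms in \<open>auto simp: in_keys_iff\<close>)

lemma tensor_eval_add: "tensor_eval (f + g) = tensor_eval f + tensor_eval g"
proof -
  let ?A = "Poly_Mapping.keys f \<union> Poly_Mapping.keys g"
  have "Poly_Mapping.keys (f + g) \<subseteq> ?A" by (rule Poly_Mapping.keys_add)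
  thus ?thesis
    by (simp add: tensor_eval_superset[of ?A] lookup_add algebra_simps sum.distrib)
qed

lemma tensor_eval_scale: "tensor_eval (fscale a f) = of_int a * tensor_eval f"
proof -
  have "Poly_Mapping.keys (fscale a f) \<subseteq> Poly_Mapping.keys f"
    by (auto simp: in_keys_iff)
  thus ?thesis
    by (simp add: tensor_eval_superset[of "Poly_Mapping.keys f"] sum_distrib_left mult.assoc)
qed

lemma tensor_eval_diff: "tensor_eval (f - g) = tensor_eval f - tensor_eval g"
  using tensor_eval_add[of "f - g" g] by simp

lemma tensor_eval_pure [simp]: "tensor_eval (pure_tensor x y) = x * y"
  by (simp add: tensor_eval_def)

lemma tensor_eval_relations:
  assumes "f \<in> tensor_relations K S1 S2"
  shows "tensor_eval f = 0"
  using assms unfolding tensor_relations_def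
proof (induction rule: free.span_induct)
  case base
  show ?case
    by (auto simp: free.subspace_def tensor_eval_add tensor_eval_scale tensor_eval_def[of 0])
next
  case (step f)
  thus ?case
    by (elim UnE CollectE exE conjE; hypsubst)
       (simp_all only: tensor_eval_diff tensor_eval_pure, simp_all add: algebra_simps)
qed

lemma tensor_mult_class:
  "tensor_mult (cong_mod (tensor_relations K S1 S2) `` {f}) = tensor_eval f"
proof -
  let ?X = "cong_mod (tensor_relations K S1 S2) `` {f}"
  have "tensor_eval g = tensor_eval f" if "g \<in> ?X" for g
    using that tensor_eval_relations[of "f - g" K S1 S2]
    by (simp add: cong_mod_def tensor_eval_diff)
  moreover have "f \<in> ?X"
    by (simp add: cong_mod_def tensor_relations_def free.span_zero)
  ultimately have "tensor_eval ` ?X = {tensor_eval f}" by blast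
  thus ?thesis by (simp add: tensor_mult_def)
qed


section \<open>Kaehler differentials\<close>

text \<open>
  \<open>\<Omega>\<^sub>R\<^sub>/\<^sub>k\<close>, where \<open>R\<close> is the type \<open>'a\<close>, is the free \<open>R\<close>-module on the symbols \<open>d r\<close>
  (for \<open>r \<in> R\<close>) modulo the relations making \<open>d\<close> additive, a derivation, and zero on \<open>k\<close>.
\<close>

abbreviation dsym :: "'a::comm_ring_1 \<Rightarrow> 'a \<Rightarrow>\<^sub>0 'a" where
  "dsym r \<equiv> Poly_Mapping.single r 1"

definition kaehler_relations :: "'a::comm_ring_1 set \<Rightarrow> ('a \<Rightarrow>\<^sub>0 'a) set" where
  "kaehler_relations k = free.span (
     {dsym (r + s) - dsym r - dsym s |r s. True} \<union>
     {dsym (r * s) - fscale r (dsym s) - fscale s (dsym r) |r s. True} \<union>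
     {dsym c |c. c \<in> k})"

definition kaehler_differentials :: "'a::comm_ring_1 set \<Rightarrow> ('a \<Rightarrow>\<^sub>0 'a) set set" where
  "kaehler_differentials k = UNIV // cong_mod (kaehler_relations k)"

definition kaehler_finitely_presented :: "'a::comm_ring_1 set \<Rightarrow> bool" where
  "kaehler_finitely_presented k \<longleftrightarrow>
     finitely_presented (kaehler_differentials k)
       (quot_add (kaehler_relations k))
       (cong_mod (kaehler_relations k) `` {0})
       (quot_scale fscale (kaehler_relations k))"


section \<open>Derivations and Hasse--Schmidt derivations\<close>

definition linear_over :: "'a::comm_ring_1 set \<Rightarrow> ('a \<Rightarrow> 'a) \<Rightarrow> bool" where
  "linear_over k f \<longleftrightarrow>
     (\<forall>x y. f (x + y) = f x + f y) \<and> (\<forall>c\<in>k. \<forall>x. f (c * x) = c * f x)"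

definition Der :: "'a::comm_ring_1 set \<Rightarrow> ('a \<Rightarrow> 'a) set" where
  "Der k = {\<delta>. linear_over k \<delta> \<and> (\<forall>x y. \<delta> (x * y) = x * \<delta> y + y * \<delta> x)}"

definition HS_derivation :: "'a::comm_ring_1 set \<Rightarrow> (nat \<Rightarrow> 'a \<Rightarrow> 'a) \<Rightarrow> bool" where
  "HS_derivation k D \<longleftrightarrow>
     D 0 = id \<and> (\<forall>\<alpha>. linear_over k (D \<alpha>)) \<and>
     (\<forall>\<alpha> x y. D \<alpha> (x * y) = (\<Sum>(i, j)\<in>{(i, j). i + j = \<alpha>}. D i x * D j y))"

definition IDer :: "'a::comm_ring_1 set \<Rightarrow> ('a \<Rightarrow> 'a) set" where
  "IDer k = {\<delta> \<in> Der k. \<exists>D. HS_derivation k D \<and> D 1 = \<delta>}"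

end

theory Submission
  imports Defs "HOL-Computational_Algebra.Polynomial" "HOL-Computational_Algebra.Primes"
    "HOL-Computational_Algebra.Formal_Power_Series"
begin

text \<open>
  Let \<open>L = Q(R)\<close> and let \<open>E\<close> be the field of elements of \<open>L\<close> fixed by every \<open>k\<close>-algebra
  homomorphism \<open>\<Phi> : L \<rightarrow> L[[t]]\<close> with \<open>\<Phi>(x) = x + O(t)\<close>, i.e. by every HS-derivation. If
  \<open>z = \<Sum>c\<in>C. c y\<^sub>c\<^sup>p\<close> lies in \<open>E\<close> and \<open>C \<subseteq> k\<close> is independent over \<open>L\<^sup>p\<close>, then
  \<open>\<Sum>c\<in>C. c (\<Phi>(y\<^sub>c) - y\<^sub>c)\<^sup>p = 0\<close>, and comparing lowest coefficients gives \<open>y\<^sub>c \<in> E\<close>.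

  Suppose every derivation is integrable. An element \<open>y \<notin> k(L\<^sup>p)\<close> is not killed by some
  \<open>k\<close>-derivation of \<open>L\<close>; since \<open>\<Omega>\<^sub>R\<^sub>/\<^sub>k\<close> is finitely generated, a multiple of it maps \<open>R\<close> to \<open>R\<close>,
  hence is integrable, and so \<open>y \<notin> E\<close>. Thus \<open>E \<subseteq> k(L\<^sup>p)\<close>, and by the first paragraph \<open>E = k(E\<^sup>p)\<close>.
  Iterating, \<open>E\<close> is contained in the intersection of the fields \<open>k(L\<^sup>q)\<close>, \<open>q = p\<^sup>n\<close>, which is finite
  over \<open>k\<close> because \<open>L\<close> is finitely generated. A basis of \<open>E\<close> over \<open>k\<close> therefore stays a basis after
  raising it to the \<open>p\<close>-th power, so \<open>E\<^sup>p\<close> and \<open>k\<close> are linearly disjoint over \<open>k\<^sup>p\<close>. But a relation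
  witnessing that \<open>R\<^sup>p\<close> and \<open>k\<close> are not linearly disjoint can, by the first paragraph, be taken with
  coefficients in \<open>E\<^sup>p\<close>.
\<close>

section \<open>Linear algebra over a subfield\<close>

lemma is_subfieldD:
  assumes "is_subfield K"
  shows "0 \<in> K" "1 \<in> K" "\<And>x y. x \<in> K \<Longrightarrow> y \<in> K \<Longrightarrow> x + y \<in> K" "\<And>x. x \<in> K \<Longrightarrow> - x \<in> K"
    "\<And>x y. x \<in> K \<Longrightarrow> y \<in> K \<Longrightarrow> x - y \<in> K"
    "\<And>x y. x \<in> K \<Longrightarrow> y \<in> K \<Longrightarrow> x * y \<in> K" "\<And>x n. x \<in> K \<Longrightarrow> x ^ n \<in> K"
    "\<And>f I. (\<And>i. i \<in> I \<Longrightarrow> f i \<in> K) \<Longrightarrow> sum f I \<in> K"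
    "\<And>x. x \<in> K \<Longrightarrow> x \<noteq> 0 \<Longrightarrow> \<exists>y\<in>K. x * y = 1"
proof -
  show 0: "0 \<in> K" and 1: "1 \<in> K" and add: "\<And>x y. x \<in> K \<Longrightarrow> y \<in> K \<Longrightarrow> x + y \<in> K"
    and neg: "\<And>x. x \<in> K \<Longrightarrow> - x \<in> K" and mult: "\<And>x y. x \<in> K \<Longrightarrow> y \<in> K \<Longrightarrow> x * y \<in> K"
    and "\<And>x. x \<in> K \<Longrightarrow> x \<noteq> 0 \<Longrightarrow> \<exists>y\<in>K. x * y = 1"
    using assms unfolding is_subfield_def by blast+
  show "x - y \<in> K" if "x \<in> K" "y \<in> K" for x y
    using add[OF that(1) neg[OF that(2)]] by simp
  show "x ^ n \<in> K" if "x \<in> K" for x n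
    using that by (induction n) (auto intro: 1 mult)
  show "sum f I \<in> K" if "\<And>i. i \<in> I \<Longrightarrow> f i \<in> K" for f :: "'b \<Rightarrow> 'a" and I
    using that by (induction I rule: infinite_finite_induct) (auto intro: 0 add)
qed

lemma is_subfield_inverse:
  fixes K :: "'a::field set"
  assumes "is_subfield K" "x \<in> K"
  shows "inverse x \<in> K"
proof (cases "x = 0")
  case False
  then obtain y where "y \<in> K" "x * y = 1"
    using is_subfieldD(9)[OF assms] by blast
  thus ?thesis by (simp add: inverse_unique)
qed (simp add: is_subfieldD(1)[OF assms(1)])

lemma is_subfield_divide:
  fixes K :: "'a::field set"
  assumes "is_subfield K" "x \<in> K" "y \<in> K"
  shows "x / y \<in> K"
  using is_subfieldD(6)[OF assms(1,2) is_subfield_inverse[OF assms(1,3)]]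
  by (simp add: divide_inverse)

lemma is_subfieldI:
  fixes K :: "'a::field set"
  assumes "1 \<in> K" "\<And>x y. x \<in> K \<Longrightarrow> y \<in> K \<Longrightarrow> x - y \<in> K" "\<And>x y. x \<in> K \<Longrightarrow> y \<in> K \<Longrightarrow> x * y \<in> K"
    "\<And>x. x \<in> K \<Longrightarrow> x \<noteq> 0 \<Longrightarrow> inverse x \<in> K"
  shows "is_subfield K"
proof -
  have 0: "0 \<in> K" using assms(2)[OF assms(1) assms(1)] by simp
  have neg: "- x \<in> K" if "x \<in> K" for x using assms(2)[OF 0 that] by simp
  have "x + y \<in> K" if "x \<in> K" "y \<in> K" for x y using assms(2)[OF that(1) neg[OF that(2)]] by simp
  moreover have "\<exists>y\<in>K. x * y = 1" if "x \<in> K" "x \<noteq> 0" for x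
    using assms(4)[OF that] that(2) by (intro bexI[of _ "inverse x"]) auto
  ultimately show ?thesis unfolding is_subfield_def using 0 neg assms by auto
qed

text \<open>\<open>K\<close> and \<open>B\<close> are arbitrary subsets with symmetric roles, so
  either may supply the scalars, and \<open>B\<close> may be infinite.\<close>

inductive_set lspan :: "'a::comm_ring_1 set \<Rightarrow> 'a set \<Rightarrow> 'a set" for K B where
  lspan_0: "0 \<in> lspan K B"
| lspan_step: "c \<in> K \<Longrightarrow> b \<in> B \<Longrightarrow> y \<in> lspan K B \<Longrightarrow> c * b + y \<in> lspan K B"

text \<open>Relations are taken along an indexed family; a set is treated as the family
  \<open>id\<close>. \<open>K\<close> may be any set, since \<open>R^p\<close>, in general only a
  ring, also occurs as a set of coefficients.\<close>

definition lindep :: "'a::comm_ring_1 set \<Rightarrow> 'i set \<Rightarrow> ('i \<Rightarrow> 'a) \<Rightarrow> bool" where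
  "lindep K I v \<longleftrightarrow> (\<exists>f. (\<forall>i. f i \<in> K) \<and> (\<exists>i\<in>I. f i \<noteq> 0) \<and> (\<Sum>i\<in>I. f i * v i) = 0)"

lemma lindepD:
  assumes "\<not> lindep K I v" "\<And>i. f i \<in> K" "(\<Sum>i\<in>I. f i * v i) = 0" "i \<in> I"
  shows "f i = 0"
  using assms unfolding lindep_def by metis

lemma lindepI:
  assumes "is_subfield K" "\<And>i. i \<in> I \<Longrightarrow> f i \<in> K" "(\<Sum>i\<in>I. f i * v i) = 0" "i \<in> I" "f i \<noteq> 0"
  shows "lindep K I v"
  unfolding lindep_def
  by (rule exI[of _ "\<lambda>i. if i \<in> I then f i else 0"])
     (use assms is_subfieldD(1)[OF assms(1)] in \<open>auto simp: if_distrib cong: sum.cong\<close>)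

section \<open>Calculus of spans\<close>

lemma lspan_add:
  assumes "x \<in> lspan K B" "y \<in> lspan K B"
  shows "x + y \<in> lspan K B"
  using assms(1) by induction (auto simp: assms(2) add.assoc intro: lspan_step)

lemma lspan_mult_closed:
  assumes "x \<in> lspan K B" "\<And>y. y \<in> K \<Longrightarrow> a * y \<in> K"
  shows "a * x \<in> lspan K B"
  using assms(1) by induction (auto simp: ring_distribs simp flip: mult.assoc intro: lspan.intros assms(2))

lemma lspan_scale: "is_subfield K \<Longrightarrow> a \<in> K \<Longrightarrow> x \<in> lspan K B \<Longrightarrow> a * x \<in> lspan K B"
  by (rule lspan_mult_closed) (auto intro: is_subfieldD)

lemma lspan_uminus: "is_subfield K \<Longrightarrow> x \<in> lspan K B \<Longrightarrow> - x \<in> lspan K B"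
  using lspan_scale[of K "-1" x B] by (simp add: is_subfieldD)

lemma lspan_diff: "is_subfield K \<Longrightarrow> x \<in> lspan K B \<Longrightarrow> y \<in> lspan K B \<Longrightarrow> x - y \<in> lspan K B"
  using lspan_add[of x K B "-y"] by (simp add: lspan_uminus)

lemma lspan_base: "is_subfield K \<Longrightarrow> b \<in> B \<Longrightarrow> b \<in> lspan K B"
  using lspan_step[of 1 K b B 0] by (simp add: is_subfieldD lspan_0)

lemma lspan_scale_base: "c \<in> K \<Longrightarrow> b \<in> B \<Longrightarrow> c * b \<in> lspan K B"
  using lspan_step[of c K b B 0] by (simp add: lspan_0)

lemma lspan_sum: "(\<And>i. i \<in> I \<Longrightarrow> f i \<in> lspan K B) \<Longrightarrow> sum f I \<in> lspan K B"
  by (induction I rule: infinite_finite_induct) (auto intro: lspan_0 lspan_add)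

lemma lspan_mono:
  assumes "K \<subseteq> K'" "B \<subseteq> B'"
  shows "lspan K B \<subseteq> lspan K' B'"
proof
  fix x assume "x \<in> lspan K B"
  thus "x \<in> lspan K' B'" by induction (use assms in \<open>auto intro: lspan.intros\<close>)
qed

lemma lspan_subset:
  assumes "is_subfield K" "B \<subseteq> lspan K A"
  shows "lspan K B \<subseteq> lspan K A"
proof
  fix x assume "x \<in> lspan K B"
  thus "x \<in> lspan K A"
    by induction (use assms in \<open>auto intro: lspan_0 lspan_add lspan_scale\<close>)
qed

lemma lspan_subset_subfield:
  assumes "is_subfield K" "k \<subseteq> K" "B \<subseteq> K"
  shows "lspan k B \<subseteq> K"
proof
  fix x assume "x \<in> lspan k B"
  thus "x \<in> K" by induction (use assms in \<open>auto intro: is_subfieldD\<close>)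
qed

lemma lspan_mult:
  assumes "\<And>x y. x \<in> K \<Longrightarrow> y \<in> K \<Longrightarrow> x * y \<in> K" "x \<in> lspan K A" "y \<in> lspan K B"
  shows "x * y \<in> lspan K {a * b |a b. a \<in> A \<and> b \<in> B}"
  using assms(2)
proof induction
  case (lspan_step c a x)
  have "c * a * y \<in> lspan K {a * b |a b. a \<in> A \<and> b \<in> B}"
    using assms(3)
  proof induction
    case (lspan_step c' b y)
    have "(c * c') * (a * b) + c * a * y \<in> lspan K {a * b |a b. a \<in> A \<and> b \<in> B}"
      using lspan_step \<open>c \<in> K\<close> \<open>a \<in> A\<close> by (intro lspan.lspan_step assms(1)) auto
    thus ?case by (simp add: algebra_simps)
  qed (simp add: lspan_0)
  with lspan_step.IH show ?case by (simp add: distrib_right lspan_add)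
qed (simp add: lspan_0)

text \<open>Generators multiply along a tower of extensions; this turns finiteness over
  \<open>perfect_core k K\<close> into finiteness over \<open>k\<close>.\<close>

lemma lspan_tower:
  assumes "is_subfield k" "x \<in> lspan K B" "K \<subseteq> lspan k C"
  shows "x \<in> lspan k {c * b |c b. c \<in> C \<and> b \<in> B}"
  using assms(2)
proof induction
  case (lspan_step c b y)
  have "c * b \<in> lspan k {c * b |c b. c \<in> C \<and> b \<in> B}"
    by (rule lspan_mult) (use assms lspan_step in \<open>auto intro: is_subfieldD lspan_base\<close>)
  with lspan_step show ?case by (blast intro: lspan_add)
qed (rule lspan_0)

text \<open>Lets an element of \<open>k(L^p)\<close>, given as a \<open>k\<close>-combination of
  \<open>p\<close>-th powers, be read as an \<open>L^p\<close>-combination of elements of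
  \<open>k\<close>.\<close>

lemma lspan_swap:
  assumes "x \<in> lspan K B"
  shows "x \<in> lspan B K"
  using assms by induction (metis mult.commute lspan.intros)+

lemma lspan_finite_subset:
  assumes "x \<in> lspan K B"
  shows "\<exists>C\<subseteq>B. finite C \<and> x \<in> lspan K C"
  using assms
proof induction
  case (lspan_step c b y)
  then obtain C where "C \<subseteq> B" "finite C" "y \<in> lspan K C" by blast
  with lspan_step show ?case
    by (intro exI[of _ "insert b C"]) (auto intro!: lspan.lspan_step intro: subsetD[OF lspan_mono])
qed (auto intro: lspan_0)

lemma lspan_finite:
  assumes "is_subfield K" "finite B" "x \<in> lspan K B"
  shows "\<exists>f. (\<forall>b. f b \<in> K) \<and> x = (\<Sum>b\<in>B. f b * b)"
  using assms(3)
proof induction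
  case lspan_0
  thus ?case by (intro exI[of _ "\<lambda>_. 0"]) (auto intro: is_subfieldD[OF assms(1)])
next
  case (lspan_step c b y)
  then obtain f where f: "\<And>b. f b \<in> K" "y = (\<Sum>b\<in>B. f b * b)" by blast
  have "c * b + y = (\<Sum>x\<in>B. (f x + (if x = b then c else 0)) * x)"
    using lspan_step(2) assms(2) by (simp add: f(2) distrib_right sum.distrib if_distrib[of "\<lambda>z. z * _"] cong: if_cong)
  thus ?case
    by (intro exI[of _ "\<lambda>x. f x + (if x = b then c else 0)"])
       (use lspan_step f in \<open>auto intro!: is_subfieldD[OF assms(1)]\<close>)
qed

lemma lspan_insert:
  assumes "is_subfield K" "x \<in> lspan K (insert b B)"
  shows "\<exists>c\<in>K. x - c * b \<in> lspan K B"
  using assms(2)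
proof induction
  case lspan_0
  thus ?case by (intro bexI[of _ 0]) (auto intro: is_subfieldD[OF assms(1)] lspan.lspan_0)
next
  case (lspan_step c a y)
  then obtain d where d: "d \<in> K" "y - d * b \<in> lspan K B" by blast
  show ?case
  proof (cases "a = b")
    case True
    thus ?thesis using d lspan_step(1)
      by (intro bexI[of _ "c + d"]) (auto simp: algebra_simps intro: is_subfieldD[OF assms(1)])
  next
    case False
    hence "c * a + (y - d * b) \<in> lspan K B"
      using d lspan_step by (intro lspan.lspan_step) auto
    thus ?thesis using d by (intro bexI[of _ d]) (auto simp: algebra_simps)
  qed
qed

text \<open>Gaussian elimination: removing a generator \<open>b\<close> costs at most one vector,
  the pivot whose multiples clear the coefficient of \<open>b\<close> from all the others.\<close>

lemma lindep_by_card: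
  assumes "is_subfield K" "finite B" "finite I" "card B < card I" "\<And>i. i \<in> I \<Longrightarrow> v i \<in> lspan K B"
  shows "lindep K I v"
  using assms(2-5)
proof (induction B arbitrary: I v rule: finite_induct)
  case empty
  then obtain i where "i \<in> I" by (metis card.empty less_irrefl ex_in_conv)
  moreover have "v i = 0" if "i \<in> I" for i
    using empty(3)[OF that] by cases auto
  ultimately show ?case
    by (intro lindepI[where f = "\<lambda>_. 1"]) (use assms(1) in \<open>auto intro: is_subfieldD simp: is_subfield_def\<close>)
next
  case (insert b B)
  note sf = is_subfieldD[OF assms(1)]
  have "\<forall>i\<in>I. \<exists>c\<in>K. v i - c * b \<in> lspan K B"
    using lspan_insert[OF assms(1)] insert.prems(3) by blast
  then obtain c where c: "\<And>i. i \<in> I \<Longrightarrow> c i \<in> K" "\<And>i. i \<in> I \<Longrightarrow> v i - c i * b \<in> lspan K B"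
    by metis
  show ?case
  proof (cases "\<forall>i\<in>I. c i = 0")
    case True
    thus ?thesis using insert c(2) by fastforce
  next
    case False
    then obtain i0 where i0: "i0 \<in> I" "c i0 \<noteq> 0" by blast
    then obtain d where d: "d \<in> K" "c i0 * d = 1" using sf(9) c(1) by blast
    \<comment> \<open>Since \<open>d\<close> is the inverse of \<open>c i0\<close>, this subtraction
      cancels the \<open>b\<close>-part of \<open>v i\<close>.\<close>
    define v' where "v' i = v i - c i * d * v i0" for i
    have "v' i \<in> lspan K B" if "i \<in> I - {i0}" for i
    proof -
      have "v' i = (v i - c i * b) - c i * d * (v i0 - c i0 * b)"
      proof -
        have "c i * d * (c i0 * b) = c i * b * (c i0 * d)" by (simp add: mult_ac)
        thus ?thesis by (simp add: v'_def d(2) right_diff_distrib)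
      qed
      moreover have "c i * d \<in> K" using that c d by (auto intro: sf)
      ultimately show ?thesis using that i0 c
        by (auto intro: lspan_diff[OF assms(1)] lspan_scale[OF assms(1)])
    qed
    moreover have "card B < card (I - {i0})"
      using insert i0 by (simp add: card_Diff_singleton)
    ultimately have "lindep K (I - {i0}) v'"
      using insert.IH[of "I - {i0}" v'] insert.prems(1) by blast
    then obtain f i1 where f: "\<And>i. f i \<in> K" "i1 \<in> I - {i0}" "f i1 \<noteq> 0" "(\<Sum>i\<in>I-{i0}. f i * v' i) = 0"
      unfolding lindep_def by blast
    \<comment> \<open>The pivot absorbs everything subtracted, so that the relation among the
      \<open>v' i\<close> becomes one among the \<open>v i\<close>.\<close>
    define g where "g i = (if i = i0 then - (\<Sum>i\<in>I-{i0}. f i * (c i * d)) else f i)" for i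
    have "(\<Sum>i\<in>I. g i * v i) = g i0 * v i0 + (\<Sum>i\<in>I-{i0}. f i * v i)"
      using i0 insert.prems(1) by (simp add: sum.remove[of I i0] g_def)
    also have "\<dots> = (\<Sum>i\<in>I-{i0}. f i * v' i)"
      by (simp add: g_def v'_def right_diff_distrib sum_subtractf sum_distrib_left sum_distrib_right mult_ac)
    finally have "(\<Sum>i\<in>I. g i * v i) = 0" using f(4) by simp
    moreover have "g i \<in> K" if "i \<in> I" for i
      using that f c d unfolding g_def by (auto intro!: sf)
    ultimately show ?thesis
      by (intro lindepI[OF assms(1), where f = g and i = i1]) (use f in \<open>auto simp: g_def\<close>)
  qed
qed

lemma lindep_mono:
  assumes "is_subfield K'" "lindep K I v" "K \<subseteq> K'" "I \<subseteq> J" "finite J"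
  shows "lindep K' J v"
proof -
  from assms(2) obtain f i where f: "\<And>i. f i \<in> K" "i \<in> I" "f i \<noteq> 0" "(\<Sum>i\<in>I. f i * v i) = 0"
    unfolding lindep_def by blast
  have "(\<Sum>i\<in>J. (if i \<in> I then f i else 0) * v i) = (\<Sum>i\<in>I. f i * v i)"
    using assms by (intro sum.mono_neutral_cong_right) auto
  thus ?thesis
    by (intro lindepI[OF assms(1), where f = "\<lambda>i. if i \<in> I then f i else 0" and i = i])
       (use assms f is_subfieldD(1)[OF assms(1)] in auto)
qed

lemma lspan_if_dependent:
  assumes "is_subfield K" "finite I" "i \<in> I" "f i \<noteq> 0" "\<And>i. i \<in> I \<Longrightarrow> f i \<in> K" "(\<Sum>i\<in>I. f i * v i) = 0"
  shows "v i \<in> lspan K (v ` (I - {i}))"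
proof -
  note sf = is_subfieldD[OF assms(1)]
  obtain d where d: "d \<in> K" "f i * d = 1" using sf(9) assms(3-5) by blast
  have "f i * v i + (\<Sum>j\<in>I-{i}. f j * v j) = 0"
    using assms by (simp add: sum.remove[of I i])
  hence "f i * v i = - (\<Sum>j\<in>I-{i}. f j * v j)" by (simp add: eq_neg_iff_add_eq_0)
  hence "f i * d * v i = - d * (\<Sum>j\<in>I-{i}. f j * v j)" by (simp add: mult_ac)
  also have "\<dots> \<in> lspan K (v ` (I - {i}))"
    using assms d by (intro lspan_scale lspan_sum lspan_base sf) (auto intro!: sf)
  finally show ?thesis by (simp add: d(2))
qed

text \<open>An independent subset of \<open>V\<close> of maximal size spans \<open>V\<close>. The
  hypothesis bounds the size of independent sets instead of giving a finite spanning set, because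
  for the perfect core of an algebraic extension only such a bound is at hand.\<close>

lemma basis_exists_bounded:
  assumes "is_subfield K" "\<And>A. A \<subseteq> V \<Longrightarrow> finite A \<Longrightarrow> card A > D \<Longrightarrow> lindep K A id"
  shows "\<exists>B\<subseteq>V. finite B \<and> \<not> lindep K B id \<and> V \<subseteq> lspan K B"
proof -
  define P where "P B \<longleftrightarrow> B \<subseteq> V \<and> finite B \<and> \<not> lindep K B id" for B
  have "P {}" by (auto simp: P_def lindep_def)
  moreover have "card B < Suc D" if "P B" for B
    using assms(2)[of B] that by (auto simp: P_def not_less[symmetric] less_Suc_eq_le)
  ultimately obtain B where B: "P B" "\<And>B'. P B' \<Longrightarrow> card B' \<le> card B"
    using ex_has_greatest_nat[of P "{}" card "Suc D"] by (metis less_imp_le)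
  have "x \<in> lspan K B" if "x \<in> V" for x
  proof (cases "x \<in> B")
    case False
    hence "\<not> P (insert x B)" using B(2)[of "insert x B"] B(1) by (auto simp: P_def)
    hence "lindep K (insert x B) id" using B(1) that by (auto simp: P_def)
    then obtain f where f: "\<And>i. f i \<in> K" "\<exists>i\<in>insert x B. f i \<noteq> 0" "(\<Sum>i\<in>insert x B. f i * i) = 0"
      unfolding lindep_def by auto
    have "f x \<noteq> 0"
    proof
      assume "f x = 0"
      hence "(\<Sum>i\<in>B. f i * id i) = 0" using f(3) False B(1) by (simp add: P_def)
      hence "f i = 0" if "i \<in> B" for i
        using B(1) f(1) that unfolding P_def by (blast intro: lindepD)
      with \<open>f x = 0\<close> f(2) show False by auto
    qed
    hence "id x \<in> lspan K (id ` (insert x B - {x}))"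
      by (intro lspan_if_dependent[where f = f]) (use assms f B(1) in \<open>auto simp: P_def\<close>)
    thus ?thesis using False by simp
  qed (simp add: lspan_base[OF assms(1)])
  thus ?thesis using B(1) unfolding P_def by blast
qed

lemma basis_exists:
  assumes "is_subfield K" "finite A" "V \<subseteq> lspan K A"
  shows "\<exists>B\<subseteq>V. finite B \<and> \<not> lindep K B id \<and> V \<subseteq> lspan K B"
proof (rule basis_exists_bounded[OF assms(1)])
  show "lindep K I id" if "I \<subseteq> V" "finite I" "card I > card A" for I
    using that assms(3) by (intro lindep_by_card[OF assms(1,2)]) auto
qed

section \<open>Adjoining an element to a subfield\<close>

definition poly_over :: "'a::field set \<Rightarrow> 'a poly set" where
  "poly_over K = {f. \<forall>i. coeff f i \<in> K}"

text \<open>The simple extension \<open>K(x)\<close>, for algebraic and transcendental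
  \<open>x\<close> alike; keeping numerator and denominator explicit gives access to their
  degrees.\<close>

definition adjoin :: "'a::field set \<Rightarrow> 'a \<Rightarrow> 'a set" where
  "adjoin K x = {poly f x / poly g x |f g. f \<in> poly_over K \<and> g \<in> poly_over K \<and> poly g x \<noteq> 0}"

lemma poly_over_closed:
  assumes "is_subfield K"
  shows "f \<in> poly_over K \<Longrightarrow> g \<in> poly_over K \<Longrightarrow> f + g \<in> poly_over K"
    "f \<in> poly_over K \<Longrightarrow> g \<in> poly_over K \<Longrightarrow> f - g \<in> poly_over K"
    "f \<in> poly_over K \<Longrightarrow> g \<in> poly_over K \<Longrightarrow> f * g \<in> poly_over K"
    "c \<in> K \<Longrightarrow> f \<in> poly_over K \<Longrightarrow> smult c f \<in> poly_over K"
    "c \<in> K \<Longrightarrow> f \<in> poly_over K \<Longrightarrow> pCons c f \<in> poly_over K"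
    "0 \<in> poly_over K" "1 \<in> poly_over K" "c \<in> K \<Longrightarrow> monom c n \<in> poly_over K"
    "(\<And>i. i \<in> I \<Longrightarrow> h i \<in> poly_over K) \<Longrightarrow> sum h I \<in> poly_over K"
  unfolding poly_over_def
  by (auto simp: coeff_mult coeff_pCons coeff_sum split: nat.split intro!: is_subfieldD[OF assms])

lemma is_subfield_adjoin:
  assumes "is_subfield K"
  shows "is_subfield (adjoin K x)"
proof (rule is_subfieldI)
  note cl = poly_over_closed[OF assms]
  show "1 \<in> adjoin K x"
    unfolding adjoin_def using cl by (auto intro!: exI[of _ 1])
  fix y z assume "y \<in> adjoin K x"
  then obtain f g where y: "f \<in> poly_over K" "g \<in> poly_over K" "poly g x \<noteq> 0" "y = poly f x / poly g x"
    unfolding adjoin_def by blast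
  show "inverse y \<in> adjoin K x" if "y \<noteq> 0"
    unfolding adjoin_def using y that by (intro CollectI exI[of _ g] exI[of _ f]) auto
  assume "z \<in> adjoin K x"
  then obtain f' g' where z: "f' \<in> poly_over K" "g' \<in> poly_over K" "poly g' x \<noteq> 0" "z = poly f' x / poly g' x"
    unfolding adjoin_def by blast
  show "y - z \<in> adjoin K x"
    unfolding adjoin_def using y z cl
    by (intro CollectI exI[of _ "f * g' - f' * g"] exI[of _ "g * g'"]) (auto simp: diff_frac_eq)
  show "y * z \<in> adjoin K x"
    unfolding adjoin_def using y z cl
    by (intro CollectI exI[of _ "f * f'"] exI[of _ "g * g'"]) auto
qed

lemma poly_in_adjoin:
  assumes "is_subfield K" "f \<in> poly_over K"
  shows "poly f x \<in> adjoin K x"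
  unfolding adjoin_def using assms poly_over_closed[OF assms(1)]
  by (intro CollectI exI[of _ f] exI[of _ 1]) auto

lemma adjoin_base: "is_subfield K \<Longrightarrow> c \<in> K \<Longrightarrow> c \<in> adjoin K x"
  using poly_in_adjoin[of K "[:c:]" x] by (simp add: poly_over_closed)

lemma adjoin_self: "is_subfield K \<Longrightarrow> x \<in> adjoin K x"
  using poly_in_adjoin[of K "[:0, 1:]" x] by (simp add: poly_over_closed is_subfieldD)

text \<open>Long division, one coefficient of \<open>g\<close> at a time, with everything kept over
  \<open>K\<close>. Asking for vanishing coefficients rather than a smaller degree covers constant
  \<open>f\<close>, where the remainder must be 0.\<close>

lemma poly_over_division:
  assumes "is_subfield K" "f \<in> poly_over K" "f \<noteq> 0" "g \<in> poly_over K"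
  shows "\<exists>q\<in>poly_over K. \<exists>r\<in>poly_over K. g = q * f + r \<and> (\<forall>i\<ge>degree f. coeff r i = 0)"
  using assms(4)
proof (induction g)
  case 0
  thus ?case by (intro bexI[of _ 0]) (auto simp: poly_over_closed[OF assms(1)])
next
  case (pCons a g)
  note cl = poly_over_closed[OF assms(1)]
  have "coeff (pCons a g) 0 \<in> K" "coeff (pCons a g) (Suc i) \<in> K" for i
    using pCons.prems unfolding poly_over_def by blast+
  hence a: "a \<in> K" and g: "g \<in> poly_over K" by (auto simp: poly_over_def)
  obtain q r where qr: "q \<in> poly_over K" "r \<in> poly_over K" "g = q * f + r" "\<And>i. i \<ge> degree f \<Longrightarrow> coeff r i = 0"
    using pCons.IH[OF g] by blast
  \<comment> \<open>From \<open>degree f\<close> on, \<open>pCons a r\<close> can have a nonzero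
    coefficient only at \<open>degree f\<close> itself; \<open>c\<close> is the multiple of
    \<open>f\<close> that cancels it.\<close>
  define c where "c = coeff (pCons a r) (degree f) / coeff f (degree f)"
  have par: "pCons a r \<in> poly_over K" using a qr(2) by (rule cl)
  hence c: "c \<in> K"
    unfolding c_def using assms(2) by (intro is_subfield_divide assms(1)) (auto simp: poly_over_def)
  show ?case
  proof (intro bexI conjI allI impI)
    show "pCons a g = (pCons 0 q + [:c:]) * f + (pCons a r - smult c f)"
      by (simp add: qr(3) algebra_simps)
    fix i assume "i \<ge> degree f"
    show "coeff (pCons a r - smult c f) i = 0"
    proof (cases "i = degree f")
      case True
      thus ?thesis using assms(3) by (simp add: c_def)
    next
      case False
      then obtain j where "i = Suc j" "j \<ge> degree f" using \<open>i \<ge> degree f\<close> by (cases i) auto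
      thus ?thesis using qr(4)[of j] by (simp add: coeff_eq_0)
    qed
  qed (use a c qr assms cl par is_subfieldD(1)[OF assms(1)] in auto)
qed

text \<open>Values of polynomials at \<open>x\<close> reduce modulo \<open>f\<close>. Denominators
  disappear because \<open>degree f + 1\<close> powers of \<open>u = g(x)\<close> are dependent:
  divided by its lowest power of \<open>u\<close>, such a relation makes \<open>1/u\<close> a
  polynomial in \<open>u\<close>.\<close>

lemma adjoin_algebraic:
  assumes K: "is_subfield K" and f: "f \<in> poly_over K" "f \<noteq> 0" "poly f x = 0"
  shows "adjoin K x \<subseteq> lspan K ((\<lambda>i. x ^ i) ` {..<degree f})" (is "_ \<subseteq> ?S")
proof -
  note cl = poly_over_closed[OF K]
  have poly_S: "poly g x \<in> ?S" if g: "g \<in> poly_over K" for g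
  proof -
    obtain q r where qr: "r \<in> poly_over K" "g = q * f + r" "\<And>i. i \<ge> degree f \<Longrightarrow> coeff r i = 0"
      using poly_over_division[OF K f(1,2) g] by blast
    have "poly g x = poly r x" using f(3) by (simp add: qr(2))
    also have "\<dots> = (\<Sum>i<degree f. coeff r i * x ^ i)"
      unfolding poly_altdef using qr(3)
      by (intro sum.mono_neutral_cong) (auto simp: coeff_eq_0 not_less)
    also have "\<dots> \<in> ?S"
      using qr(1) by (intro lspan_sum lspan_scale_base) (auto simp: poly_over_def)
    finally show ?thesis .
  qed
  have inv_S: "\<exists>h\<in>poly_over K. inverse (poly g x) = poly h x" if g: "g \<in> poly_over K" "poly g x \<noteq> 0" for g
  proof -
    define u where "u = poly g x"
    let ?D = "degree f"
    have upow: "u ^ i = poly (g ^ i) x" "g ^ i \<in> poly_over K" for i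
      by (simp_all add: u_def poly_power) (induction i, auto intro: cl g)
    have "lindep K {..?D} (\<lambda>i. u ^ i)"
    proof (rule lindep_by_card[OF K, where B = "(\<lambda>i. x ^ i) ` {..<?D}"])
      show "card ((\<lambda>i. x ^ i) ` {..<?D}) < card {..?D}"
        using card_image_le[of "{..<?D}" "\<lambda>i. x ^ i"] by simp
      show "u ^ i \<in> ?S" for i
        unfolding upow(1) by (rule poly_S[OF upow(2)])
    qed auto
    then obtain a i where a: "\<And>i. a i \<in> K" "i \<in> {..?D}" "a i \<noteq> 0" "(\<Sum>i\<in>{..?D}. a i * u ^ i) = 0"
      unfolding lindep_def by blast
    define m where "m = (LEAST i. i \<in> {..?D} \<and> a i \<noteq> 0)"
    have m: "m \<in> {..?D}" "a m \<noteq> 0"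
      using LeastI[of "\<lambda>i. i \<in> {..?D} \<and> a i \<noteq> 0" i] a(2,3) unfolding m_def by blast+
    have least: "a j = 0" if "j < m" for j
      using not_less_Least[of j "\<lambda>i. i \<in> {..?D} \<and> a i \<noteq> 0"] that m(1) unfolding m_def by auto
    have "0 = (\<Sum>i\<in>{m..?D}. a i * u ^ i)"
      unfolding a(4)[symmetric] by (rule sum.mono_neutral_right) (auto simp: least)
    also have "\<dots> = (\<Sum>i\<in>{m..?D}. u ^ m * (a i * u ^ (i - m)))"
      by (intro sum.cong) (auto simp: mult_ac simp flip: power_add)
    finally have "(\<Sum>i\<in>{m..?D}. a i * u ^ (i - m)) = 0"
      using g(2) by (simp add: u_def flip: sum_distrib_left)
    moreover have "{m..?D} = insert m {m<..?D}" using m(1) by auto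
    ultimately have *: "a m + (\<Sum>i\<in>{m<..?D}. a i * u ^ (i - m)) = 0" by simp
    have "(\<Sum>i\<in>{m<..?D}. a i * u ^ (i - m)) = u * (\<Sum>i\<in>{m<..?D}. a i * u ^ (i - m - 1))"
      by (auto simp: sum_distrib_left Suc_diff_Suc intro!: sum.cong simp flip: power_Suc power_Suc2)
    with * have "u * (\<Sum>i\<in>{m<..?D}. a i * u ^ (i - m - 1)) = - a m" by (simp add: add_eq_0_iff)
    hence "u * (\<Sum>i\<in>{m<..?D}. - a i / a m * u ^ (i - m - 1)) = 1"
      using m(2) by (simp add: sum_negf sum_divide_distrib[symmetric] flip: sum_divide_distrib)
    hence "inverse u = (\<Sum>i\<in>{m<..?D}. - a i / a m * u ^ (i - m - 1))"
      by (rule inverse_unique)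
    also have "\<dots> = poly (\<Sum>i\<in>{m<..?D}. smult (- a i / a m) (g ^ (i - m - 1))) x"
      by (simp add: poly_sum poly_power u_def)
    finally have "inverse (poly g x) = poly (\<Sum>i\<in>{m<..?D}. smult (- a i / a m) (g ^ (i - m - 1))) x"
      by (simp only: u_def)
    moreover have "(\<Sum>i\<in>{m<..?D}. smult (- a i / a m) (g ^ (i - m - 1))) \<in> poly_over K"
      by (intro cl upow(2) is_subfield_divide K is_subfieldD(4)[OF K] a(1))
    ultimately show ?thesis by blast
  qed
  show ?thesis
  proof
    fix y assume "y \<in> adjoin K x"
    then obtain g h where "g \<in> poly_over K" "h \<in> poly_over K" "poly h x \<noteq> 0" "y = poly g x / poly h x"
      unfolding adjoin_def by blast
    moreover from this inv_S obtain h' where "h' \<in> poly_over K" "inverse (poly h x) = poly h' x" by metis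
    ultimately show "y \<in> ?S" using poly_S[of "g * h'"] by (simp add: cl divide_inverse)
  qed
qed

section \<open>Subfields generated by powers\<close>

text \<open>This is the field \<open>k(K^q)\<close> when \<open>k \<subseteq> K\<close> are fields
  and \<open>q > 0\<close>: by \<open>is_subfield_powspan\<close> the span is already closed under
  division.\<close>

definition powspan :: "'a::field set \<Rightarrow> nat \<Rightarrow> 'a set \<Rightarrow> 'a set" where
  "powspan k q K = lspan k ((\<lambda>x. x ^ q) ` K)"

lemma powspan_subset: "is_subfield K \<Longrightarrow> k \<subseteq> K \<Longrightarrow> powspan k q K \<subseteq> K"
  unfolding powspan_def by (rule lspan_subset_subfield) (auto intro: is_subfieldD)

lemma powspan_base: "is_subfield k \<Longrightarrow> x \<in> K \<Longrightarrow> x ^ q \<in> powspan k q K"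
  unfolding powspan_def by (auto intro: lspan_base)

lemma powspan_scalars:
  assumes "is_subfield K"
  shows "k \<subseteq> powspan k q K"
proof
  fix c assume "c \<in> k"
  moreover have "1 \<in> (\<lambda>x. x ^ q) ` K"
    using is_subfieldD(2)[OF assms] by (intro image_eqI[of _ _ 1]) auto
  ultimately have "c * 1 \<in> powspan k q K"
    unfolding powspan_def by (rule lspan_scale_base)
  thus "c \<in> powspan k q K" by simp
qed

text \<open>Products of \<open>q\<close>-th powers are \<open>q\<close>-th powers, so the span is a
  ring; \<open>1/x = x^(q-1) * (1/x)^q\<close> gives inverses.\<close>

lemma is_subfield_powspan:
  assumes k: "is_subfield k" and K: "is_subfield K" and "k \<subseteq> K" "q > 0"
  shows "is_subfield (powspan k q K)"
proof (rule is_subfieldI)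
  have one: "1 \<in> powspan k q K"
    using powspan_base[OF k is_subfieldD(2)[OF K], of q] by simp
  thus "1 \<in> powspan k q K" .
  have mult: "x * y \<in> powspan k q K" if "x \<in> powspan k q K" "y \<in> powspan k q K" for x y
  proof -
    have "x * y \<in> lspan k {a * b |a b. a \<in> (\<lambda>x. x ^ q) ` K \<and> b \<in> (\<lambda>x. x ^ q) ` K}"
      using that unfolding powspan_def by (intro lspan_mult is_subfieldD[OF k])
    moreover have "{a * b |a b. a \<in> (\<lambda>x. x ^ q) ` K \<and> b \<in> (\<lambda>x. x ^ q) ` K} \<subseteq> (\<lambda>x. x ^ q) ` K"
      by (auto simp: is_subfieldD[OF K] simp flip: power_mult_distrib)
    ultimately show ?thesis
      unfolding powspan_def using lspan_mono[OF order_refl] by blast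
  qed
  thus "\<And>x y. x \<in> powspan k q K \<Longrightarrow> y \<in> powspan k q K \<Longrightarrow> x * y \<in> powspan k q K" .
  show "x - y \<in> powspan k q K" if "x \<in> powspan k q K" "y \<in> powspan k q K" for x y
    using that lspan_diff[OF k] unfolding powspan_def by blast
  show "inverse x \<in> powspan k q K" if x: "x \<in> powspan k q K" "x \<noteq> 0" for x
  proof -
    have "x \<in> K" using x powspan_subset[OF K \<open>k \<subseteq> K\<close>] by blast
    hence "inverse x ^ q \<in> powspan k q K"
      by (intro powspan_base k is_subfield_inverse K)
    moreover have "x ^ n \<in> powspan k q K" for n
      by (induction n) (auto intro: one mult x)
    ultimately have "x ^ (q - 1) * inverse x ^ q \<in> powspan k q K" by (rule mult[rotated])
    moreover have "x ^ (q - 1) * inverse x ^ q = inverse x"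
      using \<open>q > 0\<close> x(2) by (cases q) (auto simp: power_inverse)
    ultimately show ?thesis by simp
  qed
qed

lemma powspan_antimono:
  assumes "is_subfield K" "m \<le> n"
  shows "powspan k (p ^ n) K \<subseteq> powspan k (p ^ m) K"
proof -
  have "(x ^ p ^ n) = (x ^ p ^ (n - m)) ^ p ^ m" for x :: 'a
    using assms(2) by (simp flip: power_mult power_add)
  thus ?thesis unfolding powspan_def
    by (intro lspan_mono order_refl) (auto intro: is_subfieldD[OF assms(1)])
qed

lemma powspan_mono: "K \<subseteq> K' \<Longrightarrow> powspan k q K \<subseteq> powspan k q K'"
  unfolding powspan_def by (intro lspan_mono) auto

text \<open>A relation normalised at one index is unique over all sufficiently small fields of the chain.\<close>

lemma lindep_Inter:
  fixes K :: "nat \<Rightarrow> 'a::field set"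
  assumes K: "\<And>n. is_subfield (K n)" and dec: "\<And>m n. m \<le> n \<Longrightarrow> K n \<subseteq> K m"
    and "finite I" "\<And>n. lindep (K n) I v"
  shows "lindep (\<Inter>n. K n) I v"
  using assms(3,4)
proof (induction I rule: finite_induct)
  case empty
  thus ?case by (auto simp: lindep_def)
next
  case (insert i I)
  have Kinf: "is_subfield (\<Inter>n. K n)"
    by (rule is_subfieldI) (auto intro: is_subfieldD(2,5,6)[OF K] is_subfield_inverse[OF K])
  show ?case
  proof (cases "\<forall>n. lindep (K n) I v")
    case True
    thus ?thesis using lindep_mono[OF Kinf insert.IH order_refl] insert.hyps by blast
  next
    case False
    then obtain N where N: "\<not> lindep (K N) I v" by blast
    \<comment> \<open>From index \<open>N\<close> on, the coefficient at \<open>i\<close> cannot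
      vanish, so it can be scaled to 1.\<close>
    have "\<exists>g. (\<forall>j\<in>insert i I. g j \<in> K n) \<and> g i = 1 \<and> v i + (\<Sum>j\<in>I. g j * v j) = 0" if "n \<ge> N" for n
    proof -
      obtain f where f: "\<And>j. f j \<in> K n" "\<exists>j\<in>insert i I. f j \<noteq> 0" "f i * v i + (\<Sum>j\<in>I. f j * v j) = 0"
        using insert.prems[of n] insert.hyps unfolding lindep_def by auto
      have "f i \<noteq> 0"
      proof
        assume "f i = 0"
        hence "lindep (K n) I v" using f by (auto simp: lindep_def)
        thus False using N lindep_mono[OF K _ dec[OF that] order_refl] insert.hyps by blast
      qed
      have "v i + (\<Sum>j\<in>I. f j / f i * v j) = (f i * v i + (\<Sum>j\<in>I. f j * v j)) / f i"
        using \<open>f i \<noteq> 0\<close> by (simp add: add_divide_distrib sum_divide_distrib)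
      thus ?thesis using \<open>f i \<noteq> 0\<close> f
        by (intro exI[of _ "\<lambda>j. f j / f i"]) (auto intro: is_subfield_divide[OF K] is_subfieldD(2)[OF K])
    qed
    then obtain g where g: "\<And>n j. n \<ge> N \<Longrightarrow> j \<in> insert i I \<Longrightarrow> g n j \<in> K n"
      "\<And>n. n \<ge> N \<Longrightarrow> g n i = 1" "\<And>n. n \<ge> N \<Longrightarrow> v i + (\<Sum>j\<in>I. g n j * v j) = 0"
      by metis
    have eq: "g n j = g N j" if "n \<ge> N" "j \<in> I" for n j
    proof (rule ccontr)
      assume "g n j \<noteq> g N j"
      moreover have "(v i + (\<Sum>j\<in>I. g n j * v j)) - (v i + (\<Sum>j\<in>I. g N j * v j)) = 0"
        using g(3) that by simp
      hence "(\<Sum>j\<in>I. (g n j - g N j) * v j) = 0" by (simp add: left_diff_distrib sum_subtractf)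
      ultimately have "lindep (K N) I v"
        using that g(1) dec[OF that(1)]
        by (intro lindepI[OF K, where f = "\<lambda>j. g n j - g N j" and i = j])
           (auto intro: is_subfieldD(5)[OF K])
      with N show False by blast
    qed
    \<comment> \<open>The coefficients found at index \<open>max N n\<close> lie in
      \<open>K n\<close> and equal those found at \<open>N\<close>; hence the latter lie in every
      field of the chain.\<close>
    have gN: "g N j \<in> K n" if "j \<in> insert i I" for j n
    proof -
      have "g (max N n) j = g N j"
        using that eq[of "max N n" j] g(2)[of "max N n"] g(2)[of N] by (cases "j = i") simp_all
      hence "g N j \<in> K (max N n)" using g(1)[of "max N n" j] that by simp
      thus ?thesis using dec[of n "max N n"] by auto
    qed
    show ?thesis
      by (rule lindepI[OF Kinf, where f = "g N" and i = i])
         (use gN insert.hyps g(2,3)[of N] in auto)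
  qed
qed

section \<open>The Frobenius and simple extensions\<close>

lemma poly_map_poly_pow:
  fixes f :: "'a::field poly"
  assumes "prime CHAR('a)" "q = CHAR('a) ^ n"
  shows "poly (map_poly (\<lambda>c. c ^ q) f) (x ^ q) = poly f x ^ q"
proof -
  have "q > 0" using assms by (simp add: prime_gt_0_nat)
  show ?thesis
    by (induction f)
       (use \<open>q > 0\<close> in \<open>simp_all add: map_poly_pCons freshmans_dream'[OF assms] power_mult_distrib\<close>)
qed

text \<open>With \<open>q\<close> a power of the characteristic, \<open>(f(x)/g(x))^q\<close> is
  obtained by raising the coefficients of \<open>f\<close> and \<open>g\<close> to the
  \<open>q\<close>-th power and evaluating at \<open>x^q\<close>.\<close>

lemma powspan_adjoin:
  fixes k :: "'a::field set"
  assumes k: "is_subfield k" and K: "is_subfield K" and "k \<subseteq> K" and p: "prime CHAR('a)" "q = CHAR('a) ^ n"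
  shows "powspan k q (adjoin K x) \<subseteq> adjoin (powspan k q K) (x ^ q)"
proof -
  have q: "q > 0" using p by (simp add: prime_gt_0_nat)
  note P = is_subfield_powspan[OF k K \<open>k \<subseteq> K\<close> q]
  have map: "map_poly (\<lambda>c. c ^ q) f \<in> poly_over (powspan k q K)" if "f \<in> poly_over K" for f
    using that q by (auto simp: poly_over_def coeff_map_poly intro: powspan_base k)
  have "(\<lambda>x. x ^ q) ` adjoin K x \<subseteq> adjoin (powspan k q K) (x ^ q)"
  proof safe
    fix y assume "y \<in> adjoin K x"
    then obtain f g where y: "f \<in> poly_over K" "g \<in> poly_over K" "poly g x \<noteq> 0" "y = poly f x / poly g x"
      unfolding adjoin_def by blast
    thus "y ^ q \<in> adjoin (powspan k q K) (x ^ q)"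
      unfolding adjoin_def using map
      by (intro CollectI exI[of _ "map_poly (\<lambda>c. c ^ q) f"] exI[of _ "map_poly (\<lambda>c. c ^ q) g"])
         (auto simp: poly_map_poly_pow[OF p] power_divide)
  qed
  moreover have "k \<subseteq> adjoin (powspan k q K) (x ^ q)"
    using powspan_scalars[OF K] adjoin_base[OF P] by blast
  ultimately show ?thesis
    unfolding powspan_def[of k q "adjoin K x"]
    by (intro lspan_subset_subfield is_subfield_adjoin P)
qed

text \<open>The summands occupy the disjoint exponent blocks from \<open>q * j\<close> to
  \<open>q * j + q - 1\<close>, so nothing cancels between them.\<close>

lemma coeff_sum_monom_blocks:
  fixes u :: "nat \<Rightarrow> 'a::comm_ring_1 poly"
  assumes "\<And>j. degree (u j) < q" "i < q" "finite J" "m \<in> J"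
  shows "coeff (\<Sum>j\<in>J. monom 1 (q * j) * u j) (q * m + i) = coeff (u m) i"
proof -
  have "coeff (monom 1 (q * j) * u j) (q * m + i) = (if j = m then coeff (u m) i else 0)" for j
  proof (cases j m rule: linorder_cases)
    case less
    then obtain d where "m = Suc (j + d)" using less_imp_Suc_add by blast
    hence "q * m + i - q * j \<ge> q" by (simp add: algebra_simps)
    thus ?thesis using less assms(1)[of j] by (simp add: coeff_monom_mult coeff_eq_0)
  next
    case greater
    then obtain d where "j = Suc (m + d)" using less_imp_Suc_add by blast
    hence "\<not> q * j \<le> q * m + i" using assms(2) by (simp add: algebra_simps)
    thus ?thesis using greater by (simp add: coeff_monom_mult)
  qed (simp add: coeff_monom_mult)
  thus ?thesis using assms(3,4) by (simp add: coeff_sum)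
qed

text \<open>Over \<open>K(x\<^sup>q)\<close> the powers \<open>x\<^sup>i\<close> with \<open>i < q\<close> are independent, so an element \<open>f(x) / g(x)\<close>
  with \<open>f\<close>, \<open>g\<close> of degree below \<open>q\<close> lies in this field only if it is a constant.\<close>

lemma adjoin_transcendental_power:
  assumes K: "is_subfield K" and S: "is_subfield S" "S \<subseteq> K"
    and tr: "\<And>f. f \<in> poly_over K \<Longrightarrow> poly f x = 0 \<Longrightarrow> f = 0"
    and fg: "f \<in> poly_over K" "g \<in> poly_over K" "poly g x \<noteq> 0" "degree f < q" "degree g < q"
    and y: "poly f x / poly g x \<in> adjoin S (x ^ q)"
  shows "poly f x / poly g x \<in> S"
proof -
  note cl = poly_over_closed[OF K]
  obtain a b where ab: "a \<in> poly_over S" "b \<in> poly_over S" "poly b (x ^ q) \<noteq> 0"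
    "poly f x / poly g x = poly a (x ^ q) / poly b (x ^ q)"
    using y unfolding adjoin_def by blast
  define N where "N = max (degree a) (degree b)"
  \<comment> \<open>Clearing denominators in \<open>f(x)/g(x) = a(x^q)/b(x^q)\<close> gives
    \<open>h(x) = 0\<close>; \<open>u j\<close> is the part of \<open>h\<close> in the block of
    exponents starting at \<open>q * j\<close>.\<close>
  define u where "u j = smult (coeff b j) f - smult (coeff a j) g" for j
  define h where "h = (\<Sum>j\<le>N. monom 1 (q * j) * u j)"
  have ev: "poly c (x ^ q) = (\<Sum>j\<le>N. coeff c j * x ^ (q * j))" if "degree c \<le> N" for c :: "'a poly"
    unfolding poly_altdef power_mult
    using that by (intro sum.mono_neutral_left) (auto simp: coeff_eq_0)
  have "poly h x = poly b (x ^ q) * poly f x - poly a (x ^ q) * poly g x"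
    unfolding h_def u_def
    by (simp add: poly_sum poly_monom ev N_def right_diff_distrib sum_subtractf sum_distrib_left sum_distrib_right mult_ac)
  also have "\<dots> = 0" using ab(3,4) fg(3) by (simp add: field_simps)
  finally have "poly h x = 0" .
  moreover have "h \<in> poly_over K"
    unfolding h_def u_def using ab(1,2) S(2) fg(1,2)
    by (intro cl is_subfieldD[OF K]) (auto simp: poly_over_def)
  ultimately have "h = 0" by (rule tr[rotated])
  have "degree (u j) < q" for j
    unfolding u_def using fg(4,5) by (metis degree_diff_less degree_smult_le le_less_trans)
  hence u0: "coeff (u m) i = 0" if "i < q" "m \<le> N" for i m
    using coeff_sum_monom_blocks[of u q i "{..N}" m] that \<open>h = 0\<close> unfolding h_def by simp
  have "b \<noteq> 0" using ab(3) by auto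
  \<comment> \<open>Any block in which \<open>b\<close> has a nonzero coefficient exhibits the
    quotient as \<open>coeff a m / coeff b m\<close>, an element of \<open>S\<close>.\<close>
  define m where "m = degree b"
  have bm: "coeff b m \<noteq> 0" using \<open>b \<noteq> 0\<close> by (simp add: m_def)
  have "u m = 0"
  proof (rule poly_eqI)
    fix i show "coeff (u m) i = coeff 0 i"
      using u0[of i m] \<open>degree (u m) < q\<close> by (cases "i < q") (auto simp: N_def m_def coeff_eq_0)
  qed
  hence "smult (coeff b m) f = smult (coeff a m) g" by (simp add: u_def)
  hence "coeff b m * poly f x = coeff a m * poly g x" by (metis poly_smult)
  hence "poly f x / poly g x = coeff a m / coeff b m" using bm fg(3) by (simp add: field_simps)
  also have "\<dots> \<in> S" using ab(1,2) by (intro is_subfield_divide S) (auto simp: poly_over_def)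
  finally show ?thesis .
qed

text \<open>The elements that survive in every \<open>k(K^q)\<close>. It is defined for varying
  \<open>K\<close> so that it can be followed along a chain of simple extensions from
  \<open>k\<close> up to \<open>Q(R)\<close>.\<close>

definition perfect_core :: "'a::field set \<Rightarrow> 'a set \<Rightarrow> 'a set" where
  "perfect_core k K = (\<Inter>n. powspan k (CHAR('a) ^ n) K)"

text \<open>For transcendental \<open>x\<close> the core does not grow: a fixed fraction
  \<open>f(x)/g(x)\<close> has degrees below \<open>p^n\<close> for large \<open>n\<close>, so it
  lies in \<open>k(K^(p^n))\<close>. For algebraic \<open>x\<close> the degree of
  \<open>k(K(x)^q)\<close> over \<open>k(K^q)\<close> is at most \<open>degree f\<close> for every
  \<open>q = p^n\<close>, and this bound passes to the intersections.\<close>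

lemma perfect_core_adjoin:
  fixes k :: "'a::field set"
  assumes k: "is_subfield k" and K: "is_subfield K" and "k \<subseteq> K" and p: "prime CHAR('a)"
    and fin: "finite B" "perfect_core k K \<subseteq> lspan k B"
  shows "\<exists>B. finite B \<and> perfect_core k (adjoin K x) \<subseteq> lspan k B"
proof (cases "\<exists>f\<in>poly_over K. f \<noteq> 0 \<and> poly f x = 0")
  case False
  have p0: "CHAR('a) ^ n > 0" for n using p by (simp add: prime_gt_0_nat)
  note P = is_subfield_powspan[OF k K \<open>k \<subseteq> K\<close> p0]
  have "perfect_core k (adjoin K x) \<subseteq> perfect_core k K"
  proof
    fix y assume y: "y \<in> perfect_core k (adjoin K x)"
    have "powspan k (CHAR('a) ^ 0) (adjoin K x) \<subseteq> adjoin K x"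
      using \<open>k \<subseteq> K\<close> by (intro powspan_subset is_subfield_adjoin K) (auto intro: adjoin_base K)
    with y have "y \<in> adjoin K x" unfolding perfect_core_def by blast
    then obtain f g where fg: "f \<in> poly_over K" "g \<in> poly_over K" "poly g x \<noteq> 0" "y = poly f x / poly g x"
      unfolding adjoin_def by blast
    \<comment> \<open>As \<open>n < p^n\<close>, this crude sum suffices for both degrees; smaller
      exponents follow because the chain of fields decreases.\<close>
    define N where "N = degree f + degree g"
    have *: "y \<in> powspan k (CHAR('a) ^ n) K" if "n \<ge> N" for n
    proof -
      have "n < CHAR('a) ^ n" using prime_gt_1_nat[OF p] by (simp add: power_gt_expt)
      hence "degree f < CHAR('a) ^ n" "degree g < CHAR('a) ^ n" using that by (auto simp: N_def)
      moreover have "y \<in> adjoin (powspan k (CHAR('a) ^ n) K) (x ^ CHAR('a) ^ n)"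
        using y powspan_adjoin[OF k K \<open>k \<subseteq> K\<close> p refl] unfolding perfect_core_def by blast
      ultimately show ?thesis unfolding fg(4)
        by (intro adjoin_transcendental_power[OF K P powspan_subset[OF K \<open>k \<subseteq> K\<close>] _ fg(1-3)]) 
           (use False in auto)
    qed
    have "y \<in> powspan k (CHAR('a) ^ n) K" for n
      using *[of "max n N"] powspan_antimono[OF K, of n "max n N" k "CHAR('a)"] by auto
    thus "y \<in> perfect_core k K" by (simp add: perfect_core_def)
  qed
  thus ?thesis using fin by blast
next
  case True
  then obtain f where f: "f \<in> poly_over K" "f \<noteq> 0" "poly f x = 0" by blast
  have p0: "CHAR('a) ^ n > 0" for n using p by (simp add: prime_gt_0_nat)
  note P = is_subfield_powspan[OF k K \<open>k \<subseteq> K\<close> p0]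
  define D where "D = degree f"
  have core: "is_subfield (perfect_core k K)"
    unfolding perfect_core_def
    by (rule is_subfieldI) (auto intro: is_subfieldD(2,5,6)[OF P] is_subfield_inverse[OF P])
  \<comment> \<open>The Frobenius carries the powers of \<open>x\<close> spanning
    \<open>K(x)\<close> over \<open>K\<close> to generators over \<open>k(K^q)\<close>, so
    \<open>D\<close> generators suffice for every \<open>n\<close>.\<close>
  have span: "powspan k (CHAR('a) ^ n) (adjoin K x) \<subseteq>
     lspan (powspan k (CHAR('a) ^ n) K) ((\<lambda>i. (x ^ i) ^ (CHAR('a) ^ n)) ` {..<D})" (is "_ \<subseteq> ?S n") for n
  proof -
    let ?q = "CHAR('a) ^ n"
    have "y ^ ?q \<in> ?S n" if "y \<in> adjoin K x" for y
    proof -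
      have "y \<in> lspan K ((\<lambda>i. x ^ i) ` {..<D})"
        using adjoin_algebraic[OF K f] that unfolding D_def by blast
      thus ?thesis
      proof induction
        case lspan_0
        have "0 ^ ?q = (0::'a)" using p0 by (rule zero_power)
        thus ?case by (simp only: lspan.lspan_0)
      next
        case (lspan_step c b z)
        have "c ^ ?q * b ^ ?q + z ^ ?q \<in> ?S n"
          using lspan_step by (intro lspan.lspan_step powspan_base k) auto
        thus ?case by (simp add: freshmans_dream'[OF p] power_mult_distrib)
      qed
    qed
    moreover have "k \<subseteq> powspan k ?q K"
      by (rule powspan_scalars[OF K])
    hence "lspan k (?S n) \<subseteq> lspan (powspan k ?q K) (?S n)" by (intro lspan_mono order_refl)
    moreover have "\<dots> \<subseteq> ?S n" by (rule lspan_subset[OF P order_refl])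
    ultimately show ?thesis
      unfolding powspan_def[of k ?q "adjoin K x"]
      using lspan_mono[OF order_refl, of "(\<lambda>x. x ^ ?q) ` adjoin K x" "?S n" k] by blast
  qed
  \<comment> \<open>A relation exists at each finite level; \<open>lindep_Inter\<close> provides one
    with coefficients in the core.\<close>
  have dep: "lindep (perfect_core k K) A id"
    if A: "A \<subseteq> perfect_core k (adjoin K x)" "finite A" "card A > D" for A
    unfolding perfect_core_def
  proof (rule lindep_Inter[OF P powspan_antimono[OF K] A(2)])
    fix n
    have "card ((\<lambda>i. (x ^ i) ^ (CHAR('a) ^ n)) ` {..<D}) < card A"
      using card_image_le[of "{..<D}"] A(3) by (metis card_lessThan finite_lessThan le_less_trans)
    thus "lindep (powspan k (CHAR('a) ^ n) K) A id"
      using A span[of n] by (intro lindep_by_card[OF P _ A(2)]) (auto simp: perfect_core_def)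
  qed
  obtain C where C: "finite C" "perfect_core k (adjoin K x) \<subseteq> lspan (perfect_core k K) C"
    using basis_exists_bounded[OF core dep] by blast
  have "finite {b * c |b c. b \<in> B \<and> c \<in> C}"
    using C(1) fin(1) by (rule_tac finite_subset[of _ "(\<lambda>(b, c). b * c) ` (B \<times> C)"]) auto
  moreover have "perfect_core k (adjoin K x) \<subseteq> lspan k {b * c |b c. b \<in> B \<and> c \<in> C}"
    using C(2) lspan_tower[OF k _ fin(2)] by blast
  ultimately show ?thesis by blast
qed

text \<open>The generators are adjoined one at a time, starting from \<open>k\<close>, which is its
  own perfect core. The induction only produces some subfield containing
  \<open>k \<union> S\<close>, which the assumption on \<open>field_generated\<close> forces to be
  everything.\<close>

lemma perfect_core_finite:
  fixes k :: "'a::field set"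
  assumes k: "is_subfield k" and p: "prime CHAR('a)" and S: "finite S" "field_generated (k \<union> S) = UNIV"
  shows "\<exists>B. finite B \<and> perfect_core k UNIV \<subseteq> lspan k B"
proof -
  have "\<exists>K. is_subfield K \<and> k \<union> S \<subseteq> K \<and> (\<exists>B. finite B \<and> perfect_core k K \<subseteq> lspan k B)"
    using S(1)
  proof (induction S rule: finite_induct)
    case empty
    have "powspan k (CHAR('a) ^ 0) k \<subseteq> k" by (rule powspan_subset[OF k order_refl])
    also have "k \<subseteq> lspan k {1}" using lspan_scale_base[of _ k 1 "{1}"] by auto
    finally have "perfect_core k k \<subseteq> lspan k {1}" unfolding perfect_core_def by blast
    thus ?case using k by (intro exI[of _ k]) auto
  next
    case (insert x S)
    then obtain K B where K: "is_subfield K" "k \<union> S \<subseteq> K" "finite B" "perfect_core k K \<subseteq> lspan k B" by blast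
    have "\<exists>B. finite B \<and> perfect_core k (adjoin K x) \<subseteq> lspan k B"
      using K by (intro perfect_core_adjoin[OF k K(1) _ p K(3,4)]) auto
    thus ?case using K
      by (intro exI[of _ "adjoin K x"]) (auto intro: is_subfield_adjoin adjoin_self adjoin_base)
  qed
  then obtain K where K: "is_subfield K" "k \<union> S \<subseteq> K" "\<exists>B. finite B \<and> perfect_core k K \<subseteq> lspan k B" by blast
  have "field_generated (k \<union> S) \<subseteq> K" using K(1,2) unfolding field_generated_def by blast
  hence "K = UNIV" using S(2) by blast
  thus ?thesis using K(3) by simp
qed

section \<open>Hasse--Schmidt derivations as homomorphisms into power series\<close>

text \<open>An HS-derivation of infinite length packed as its generating series:
  \<open>fps_nth (\<Phi> x) n\<close> is \<open>D n x\<close>, and the Leibniz rules say that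
  \<open>\<Phi>\<close> is multiplicative. Given this, linearity over \<open>k\<close> amounts to
  additivity and constant values on \<open>k\<close>.\<close>

definition hs_hom :: "'a::field set \<Rightarrow> ('a \<Rightarrow> 'a fps) \<Rightarrow> bool" where
  "hs_hom k \<Phi> \<longleftrightarrow>
     (\<forall>x y. \<Phi> (x + y) = \<Phi> x + \<Phi> y) \<and> (\<forall>x y. \<Phi> (x * y) = \<Phi> x * \<Phi> y) \<and>
     (\<forall>c\<in>k. \<Phi> c = fps_const c) \<and> (\<forall>x. fps_nth (\<Phi> x) 0 = x)"

text \<open>The field \<open>E\<close> of the overview: the elements killed by all positive-order
  components of all HS-derivations.\<close>

definition hs_fixed :: "'a::field set \<Rightarrow> 'a set" where
  "hs_fixed k = {x. \<forall>\<Phi>. hs_hom k \<Phi> \<longrightarrow> \<Phi> x = fps_const x}"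

lemma hs_homD:
  assumes "hs_hom k \<Phi>" "is_subfield k"
  shows "\<Phi> (x + y) = \<Phi> x + \<Phi> y" "\<Phi> (x - y) = \<Phi> x - \<Phi> y" "\<Phi> (x * y) = \<Phi> x * \<Phi> y"
    "c \<in> k \<Longrightarrow> \<Phi> c = fps_const c" "\<Phi> 0 = 0" "\<Phi> 1 = 1" "\<Phi> (x ^ n) = \<Phi> x ^ n" "\<Phi> (sum f I) = (\<Sum>i\<in>I. \<Phi> (f i))"
proof -
  show add: "\<Phi> (x + y) = \<Phi> x + \<Phi> y" and mult: "\<Phi> (x * y) = \<Phi> x * \<Phi> y"
    and const: "c \<in> k \<Longrightarrow> \<Phi> c = fps_const c" for x y c
    using assms(1) unfolding hs_hom_def by blast+
  show "\<Phi> (x - y) = \<Phi> x - \<Phi> y" using add[of "x - y" y] by simp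
  show 0: "\<Phi> 0 = 0" and 1: "\<Phi> 1 = 1"
    using const[OF is_subfieldD(1)[OF assms(2)]] const[OF is_subfieldD(2)[OF assms(2)]] by simp_all
  show "\<Phi> (x ^ n) = \<Phi> x ^ n" by (induction n) (simp_all add: 1 mult)
  show "\<Phi> (sum f I) = (\<Sum>i\<in>I. \<Phi> (f i))"
    by (induction I rule: infinite_finite_induct) (simp_all add: 0 add)
qed

lemma hs_fixed_base: "k \<subseteq> hs_fixed k"
  by (auto simp: hs_fixed_def hs_hom_def)

lemma is_subfield_hs_fixed:
  assumes "is_subfield k"
  shows "is_subfield (hs_fixed k)"
proof (rule is_subfieldI)
  show "1 \<in> hs_fixed k" using hs_fixed_base is_subfieldD(2)[OF assms] by blast
  show "x - y \<in> hs_fixed k" "x * y \<in> hs_fixed k" if "x \<in> hs_fixed k" "y \<in> hs_fixed k" for x y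
  proof -
    have fixed: "\<Phi> x = fps_const x" "\<Phi> y = fps_const y" if "hs_hom k \<Phi>" for \<Phi>
      using \<open>x \<in> hs_fixed k\<close> \<open>y \<in> hs_fixed k\<close> that by (simp_all add: hs_fixed_def)
    show "x - y \<in> hs_fixed k" "x * y \<in> hs_fixed k"
      unfolding hs_fixed_def by (simp_all add: hs_homD[OF _ assms] fixed)
  qed
  show "inverse x \<in> hs_fixed k" if x: "x \<in> hs_fixed k" "x \<noteq> 0" for x
    unfolding hs_fixed_def
  proof (intro CollectI allI impI)
    fix \<Phi> assume \<Phi>: "hs_hom k \<Phi>"
    hence "\<Phi> x = fps_const x" using x(1) by (auto simp: hs_fixed_def)
    moreover have "\<Phi> x * \<Phi> (inverse x) = 1"
      using x(2) hs_homD(3)[OF \<Phi> assms, of x "inverse x"] hs_homD(6)[OF \<Phi> assms] by simp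
    ultimately have "fps_const (inverse x) * (fps_const x * \<Phi> (inverse x)) = fps_const (inverse x)" by simp
    thus "\<Phi> (inverse x) = fps_const (inverse x)"
      using x(2) by (simp add: mult.assoc[symmetric])
  qed
qed

text \<open>By induction on \<open>n\<close> every \<open>w i\<close> is divisible by
  \<open>X^n\<close>. After division by \<open>X^(n * p)\<close> the constant terms form a relation
  among the \<open>c i\<close> with \<open>p\<close>-th powers as coefficients, so the coefficients
  of \<open>X^n\<close> vanish as well.\<close>

lemma fps_power_relation_zero:
  fixes c :: "'i \<Rightarrow> 'a::field" and w :: "'i \<Rightarrow> 'a fps"
  assumes "\<not> lindep (range (\<lambda>x. x ^ p)) I c" "(\<Sum>i\<in>I. fps_const (c i) * w i ^ p) = 0" "i \<in> I"
  shows "w i = 0"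
proof -
  have "\<forall>i\<in>I. fps_nth (w i) n = 0" for n
  proof (induction n rule: less_induct)
    case (less n)
    have w: "w i = fps_X ^ n * fps_shift n (w i)" if "i \<in> I" for i
      by (rule fps_ext) (use less that in \<open>auto simp: fps_X_power_mult_nth\<close>)
    have "(\<Sum>i\<in>I. fps_const (c i) * w i ^ p) = (\<Sum>i\<in>I. (fps_X ^ n) ^ p * (fps_const (c i) * fps_shift n (w i) ^ p))"
      by (intro sum.cong refl, subst w) (simp_all add: power_mult_distrib mult_ac)
    hence "(\<Sum>i\<in>I. fps_const (c i) * fps_shift n (w i) ^ p) = 0"
      using assms(2) by (simp flip: sum_distrib_left)
    hence "fps_nth (\<Sum>i\<in>I. fps_const (c i) * fps_shift n (w i) ^ p) 0 = 0" by simp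
    hence "(\<Sum>i\<in>I. fps_nth (w i) n ^ p * c i) = 0"
      by (simp add: fps_sum_nth fps_power_zeroth mult.commute)
    hence z: "fps_nth (w i) n ^ p = 0" if "i \<in> I" for i
      by (rule lindepD[OF assms(1), rotated]) (use that in auto)
    show ?case
    proof
      fix i assume "i \<in> I"
      thus "fps_nth (w i) n = 0" using z[of i] by simp
    qed
  qed
  thus ?thesis using assms(3) by (auto intro: fps_ext)
qed

section \<open>The fixed field and \<open>p\<close>-th powers\<close>

lemma prime_char_diff_power:
  fixes x y :: "'a::comm_ring_1"
  assumes "prime CHAR('a)"
  shows "(x - y) ^ CHAR('a) = x ^ CHAR('a) - y ^ CHAR('a)"
  using freshmans_dream[OF assms refl, of "x - y" y] by (simp add: algebra_simps)

lemma hs_fixed_coefficients: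
  fixes k :: "'a::field set"
  assumes k: "is_subfield k" and p: "prime CHAR('a)" and C: "C \<subseteq> k"
    "\<not> lindep (range (\<lambda>x. x ^ CHAR('a))) C id"
    and y: "(\<Sum>c\<in>C. c * y c ^ CHAR('a)) \<in> hs_fixed k" "c \<in> C"
  shows "y c \<in> hs_fixed k"
  unfolding hs_fixed_def
proof (intro CollectI allI impI)
  let ?p = "CHAR('a)"
  fix \<Phi> assume \<Phi>: "hs_hom k \<Phi>"
  note hom = hs_homD[OF \<Phi> k]
  \<comment> \<open>Power series inherit the characteristic, so the Frobenius is additive on them
    and turns the difference of \<open>\<Phi> z\<close> and \<open>z\<close> into the sum of the
    \<open>c * (\<Phi> (y c) - y c)^p\<close>.\<close>
  have pf: "prime CHAR('a fps)" using p by simp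
  have diff: "(f - g) ^ ?p = f ^ ?p - g ^ ?p" for f g :: "'a fps"
    using prime_char_diff_power[OF pf] by simp
  have const_sum: "fps_const (sum f C) = (\<Sum>c\<in>C. fps_const (f c))" for f :: "'a \<Rightarrow> 'a"
    by (rule fps_ext) (simp add: fps_sum_nth)
  have "fps_const (\<Sum>c\<in>C. c * y c ^ ?p) = \<Phi> (\<Sum>c\<in>C. c * y c ^ ?p)"
    using y(1) \<Phi> by (auto simp: hs_fixed_def)
  also have "\<dots> = (\<Sum>c\<in>C. fps_const c * \<Phi> (y c) ^ ?p)"
    unfolding hom using C(1) by (intro sum.cong) (auto simp: hom)
  finally have "(\<Sum>c\<in>C. fps_const (id c) * (\<Phi> (y c) - fps_const (y c)) ^ ?p) = 0"
    by (simp add: diff right_diff_distrib sum_subtractf const_sum)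
  hence "\<Phi> (y c) - fps_const (y c) = 0" by (rule fps_power_relation_zero[OF C(2) _ y(2)])
  thus "\<Phi> (y c) = fps_const (y c)" by simp
qed

text \<open>The Frobenius is a ring homomorphism and so carries subfields to subfields; a domain is
  allowed because \<open>k\<close> is given inside \<open>R\<close>.\<close>

lemma is_subfield_power_image:
  fixes K :: "'a::idom set"
  assumes "is_subfield K" "prime CHAR('a)"
  shows "is_subfield ((\<lambda>x. x ^ CHAR('a)) ` K)"
proof -
  let ?p = "CHAR('a)"
  note sf = is_subfieldD[OF assms(1)]
  have p0: "?p > 0" using assms(2) by (simp add: prime_gt_0_nat)
  have "\<exists>y\<in>(\<lambda>x. x ^ ?p) ` K. x ^ ?p * y = 1" if "x \<in> K" "x ^ ?p \<noteq> 0" for x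
  proof -
    from that p0 have "x \<noteq> 0" by auto
    then obtain z where "z \<in> K" "x * z = 1" using sf(9) \<open>x \<in> K\<close> by blast
    thus ?thesis by (intro bexI[of _ "z ^ ?p"]) (auto simp flip: power_mult_distrib)
  qed
  moreover have "x ^ ?p + y ^ ?p \<in> (\<lambda>x. x ^ ?p) ` K" if "x \<in> K" "y \<in> K" for x y
    using that by (auto simp: sf simp flip: freshmans_dream[OF assms(2) refl])
  moreover have "- (x ^ ?p) \<in> (\<lambda>x. x ^ ?p) ` K" if "x \<in> K" for x
  proof -
    have "- (x ^ ?p) = (- x) ^ ?p" by (simp add: minus_power_prime_CHAR[OF refl assms(2)])
    thus ?thesis using that sf(4) by blast
  qed
  moreover have "x ^ ?p * y ^ ?p \<in> (\<lambda>x. x ^ ?p) ` K" if "x \<in> K" "y \<in> K" for x y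
    using that by (auto simp: sf simp flip: power_mult_distrib)
  moreover have "0 ^ ?p = (0::'a)" using p0 by (rule zero_power)
  hence "0 \<in> (\<lambda>x. x ^ ?p) ` K" using sf(1) by force
  moreover have "1 \<in> (\<lambda>x. x ^ ?p) ` K" using sf(2) by force
  ultimately show ?thesis unfolding is_subfield_def by auto
qed

lemma is_subfield_UNIV: "is_subfield (UNIV :: 'a::field set)"
  by (rule is_subfieldI) auto

text \<open>An element of \<open>E\<close> is an \<open>L^p\<close>-combination of elements of
  \<open>k\<close>. Passing to an \<open>L^p\<close>-independent set of these makes
  \<open>hs_fixed_coefficients\<close> applicable, and the \<open>p\<close>-th roots of the
  coefficients land in \<open>E\<close>.\<close>

lemma hs_fixed_powspan_self:
  fixes k :: "'a::field set"
  assumes k: "is_subfield k" and p: "prime CHAR('a)"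
    and sub: "hs_fixed k \<subseteq> powspan k CHAR('a) UNIV"
  shows "hs_fixed k \<subseteq> powspan k CHAR('a) (hs_fixed k)"
proof
  let ?p = "CHAR('a)"
  let ?K = "range (\<lambda>x::'a. x ^ ?p)"
  have K: "is_subfield ?K" by (rule is_subfield_power_image[OF is_subfield_UNIV p])
  fix y assume y: "y \<in> hs_fixed k"
  hence "y \<in> lspan ?K k" using sub unfolding powspan_def by (blast intro: lspan_swap)
  then obtain C0 where C0: "C0 \<subseteq> k" "finite C0" "y \<in> lspan ?K C0" using lspan_finite_subset by blast
  obtain C where C: "C \<subseteq> C0" "finite C" "\<not> lindep ?K C id" "C0 \<subseteq> lspan ?K C"
    using basis_exists[OF K C0(2), of C0] lspan_base[OF K] by blast
  have "y \<in> lspan ?K C" using C0(3) lspan_subset[OF K C(4)] by blast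
  then obtain f where f: "\<And>c. f c \<in> ?K" "y = (\<Sum>c\<in>C. f c * c)"
    using lspan_finite[OF K C(2)] by metis
  from f(1) obtain z where z: "\<And>c. f c = z c ^ ?p" by (auto simp: image_iff) metis
  have y_eq: "y = (\<Sum>c\<in>C. c * z c ^ ?p)" by (simp add: f(2) z mult.commute)
  have "z c \<in> hs_fixed k" if "c \<in> C" for c
    by (rule hs_fixed_coefficients[OF k p _ C(3)]) (use C(1) C0(1) y y_eq that in auto)
  thus "y \<in> powspan k ?p (hs_fixed k)"
    unfolding y_eq powspan_def using C(1) C0(1) by (intro lspan_sum lspan_scale_base) auto
qed

text \<open>The Frobenius carries \<open>E \<subseteq> k(E^(p^n))\<close> to
  \<open>E^p \<subseteq> k(E^(p^(n+1)))\<close>, and \<open>E\<close> lies in the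
  \<open>k\<close>-span of \<open>E^p\<close>.\<close>

lemma subset_powspan_iterate:
  fixes k :: "'a::field set"
  assumes k: "is_subfield k" and p: "prime CHAR('a)" and E: "E \<subseteq> powspan k CHAR('a) E"
  shows "E \<subseteq> powspan k (CHAR('a) ^ n) E"
proof (induction n)
  case 0
  thus ?case by (auto simp: powspan_def intro: lspan_base[OF k])
next
  case (Suc n)
  let ?p = "CHAR('a)"
  have "x ^ ?p \<in> powspan k (?p ^ Suc n) E" if "x \<in> powspan k (?p ^ n) E" for x
    using that unfolding powspan_def
  proof induction
    case lspan_0
    have "0 ^ ?p = (0::'a)" using p by (intro zero_power prime_gt_0_nat)
    thus ?case by (simp only: lspan.lspan_0)
  next
    case (lspan_step c b y)
    then obtain e where e: "e \<in> E" "b = e ^ ?p ^ n" by blast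
    have "c ^ ?p * (e ^ ?p ^ Suc n) + y ^ ?p \<in> lspan k ((\<lambda>x. x ^ ?p ^ Suc n) ` E)"
      using lspan_step e by (intro lspan.lspan_step is_subfieldD[OF k]) auto
    also have "e ^ ?p ^ Suc n = b ^ ?p" unfolding e(2) by (simp add: mult.commute flip: power_mult)
    finally show ?case by (simp add: freshmans_dream[OF p] power_mult_distrib)
  qed
  with Suc have "(\<lambda>x. x ^ ?p) ` E \<subseteq> powspan k (?p ^ Suc n) E" by blast
  hence "powspan k ?p E \<subseteq> powspan k (?p ^ Suc n) E"
    unfolding powspan_def by (rule lspan_subset[OF k])
  with E show ?case by blast
qed

text \<open>The \<open>p\<close>-th powers of a finite basis of \<open>E\<close> over \<open>k\<close> again span \<open>E\<close>, hence form a basis.\<close>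

lemma indep_powers_of_finite_extension:
  fixes k :: "'a::field set"
  assumes k: "is_subfield k" and p: "prime CHAR('a)" and E: "E \<subseteq> powspan k CHAR('a) E"
    and fin: "finite B0" "E \<subseteq> lspan k B0"
    and C: "C \<subseteq> k" "\<not> lindep ((\<lambda>x. x ^ CHAR('a)) ` k) C id" "finite C"
    and y: "\<And>c. c \<in> C \<Longrightarrow> y c \<in> E" "(\<Sum>c\<in>C. c * y c ^ CHAR('a)) = 0" "c \<in> C"
  shows "y c = 0"
proof -
  let ?p = "CHAR('a)"
  obtain B where B: "B \<subseteq> E" "finite B" "\<not> lindep k B id" "E \<subseteq> lspan k B"
    using basis_exists[OF k fin] by blast
  have powB: "x ^ ?p \<in> lspan k ((\<lambda>x. x ^ ?p) ` B)" if "x \<in> lspan k B" for x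
    using that
  proof induction
    case lspan_0
    have "0 ^ ?p = (0::'a)" using p by (intro zero_power prime_gt_0_nat)
    thus ?case by (simp only: lspan.lspan_0)
  next
    case (lspan_step c b y)
    have "c ^ ?p * b ^ ?p + y ^ ?p \<in> lspan k ((\<lambda>x. x ^ ?p) ` B)"
      using lspan_step by (intro lspan.lspan_step is_subfieldD[OF k]) auto
    thus ?case by (simp add: freshmans_dream[OF p] power_mult_distrib)
  qed
  have E_span: "E \<subseteq> lspan k ((\<lambda>x. x ^ ?p) ` B)"
    using E lspan_subset[OF k, of "(\<lambda>x. x ^ ?p) ` E" "(\<lambda>x. x ^ ?p) ` B"] powB B(4)
    unfolding powspan_def by blast
  \<comment> \<open>A relation would leave fewer than \<open>card B\<close> elements spanning
    \<open>E\<close>, against the independence of \<open>B\<close>.\<close>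
  have indep: "\<not> lindep k B (\<lambda>b. b ^ ?p)"
  proof
    assume "lindep k B (\<lambda>b. b ^ ?p)"
    then obtain f b where f: "\<And>b. f b \<in> k" "b \<in> B" "f b \<noteq> 0" "(\<Sum>b\<in>B. f b * b ^ ?p) = 0"
      unfolding lindep_def by blast
    let ?B' = "(\<lambda>x. x ^ ?p) ` (B - {b})"
    have "b ^ ?p \<in> lspan k ?B'"
      using f by (intro lspan_if_dependent[OF k B(2), where f = f]) auto
    hence "(\<lambda>x. x ^ ?p) ` B \<subseteq> lspan k ?B'" using lspan_base[OF k, of _ ?B'] by blast
    hence "E \<subseteq> lspan k ?B'" using E_span lspan_subset[OF k] by blast
    moreover have "card ?B' < card B"
      using card_image_le[of "B - {b}" "\<lambda>x. x ^ ?p"] f(2) B(2) card_Diff1_less[of B b] by simp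
    ultimately have "lindep k B id" using B by (intro lindep_by_card[OF k, of ?B']) auto
    with B(3) show False by blast
  qed
  have "\<exists>a. (\<forall>b. a b \<in> k) \<and> y c = (\<Sum>b\<in>B. a b * b)" if "c \<in> C" for c
    using lspan_finite[OF k B(2)] B(4) y(1)[OF that] by blast
  then obtain a where a: "\<And>c b. c \<in> C \<Longrightarrow> a c b \<in> k" "\<And>c. c \<in> C \<Longrightarrow> y c = (\<Sum>b\<in>B. a c b * b)"
    by metis
  \<comment> \<open>When each \<open>y c\<close> is expanded in the basis \<open>B\<close> and the
    sums are exchanged, these are the coefficients of the independent elements
    \<open>b ^ p\<close>.\<close>
  have pC: "(\<Sum>c\<in>C. c * a c b ^ ?p) = 0" if "b \<in> B" for b
  proof (rule lindepD[OF indep _ _ that])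
    show "(\<Sum>c\<in>C. c * a c b ^ ?p) \<in> k" for b
      using C(1) a(1) by (intro is_subfieldD[OF k]) auto
    have "(\<Sum>b\<in>B. (\<Sum>c\<in>C. c * a c b ^ ?p) * b ^ ?p) = (\<Sum>c\<in>C. c * (\<Sum>b\<in>B. (a c b * b) ^ ?p))"
      unfolding sum_distrib_right sum_distrib_left power_mult_distrib
      by (subst sum.swap) (simp add: mult_ac)
    also have "\<dots> = (\<Sum>c\<in>C. c * y c ^ ?p)"
      by (intro sum.cong refl) (simp add: a(2) freshmans_dream_sum[OF p refl])
    finally show "(\<Sum>b\<in>B. (\<Sum>c\<in>C. c * a c b ^ ?p) * b ^ ?p) = 0" using y(2) by simp
  qed
  have "a c b = 0" if b: "b \<in> B" for b
  proof (rule ccontr)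
    assume "a c b \<noteq> 0"
    have "lindep ((\<lambda>x. x ^ ?p) ` k) C id"
      by (rule lindepI[OF is_subfield_power_image[OF k p], where f = "\<lambda>c. a c b ^ ?p" and i = c])
         (use a(1) y(3) \<open>a c b \<noteq> 0\<close> pC[OF b] in \<open>auto simp: mult.commute\<close>)
    with C(2) show False by blast
  qed
  thus ?thesis using a(2)[OF y(3)] by simp
qed

text \<open>Induction on \<open>C\<close>: as \<open>C\<close> is independent over
  \<open>L^p\<close>, a relation on \<open>insert c0 C\<close> can be normalised so that
  \<open>- c0\<close> is the sum of the \<open>c * y c ^ p\<close>. Since \<open>- c0\<close> is in
  \<open>k\<close>, hence in \<open>E\<close>, all \<open>y c\<close> lie in \<open>E\<close>, and
  the finiteness of \<open>E\<close> over \<open>k\<close> excludes the relation.\<close>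

lemma indep_powers_if_hs_fixed_small:
  fixes k :: "'a::field set"
  assumes k: "is_subfield k" and p: "prime CHAR('a)" and S: "finite S" "field_generated (k \<union> S) = UNIV"
    and sub: "hs_fixed k \<subseteq> powspan k CHAR('a) UNIV"
    and C: "finite C" "C \<subseteq> k" "\<not> lindep ((\<lambda>x. x ^ CHAR('a)) ` k) C id"
  shows "\<not> lindep (range (\<lambda>x. x ^ CHAR('a))) C id"
  using C
proof (induction C rule: finite_induct)
  case empty
  thus ?case by (simp add: lindep_def)
next
  case (insert c0 C)
  let ?p = "CHAR('a)"
  let ?K = "range (\<lambda>x::'a. x ^ ?p)"
  have K: "is_subfield ?K" by (rule is_subfield_power_image[OF is_subfield_UNIV p])
  have "\<not> lindep ((\<lambda>x. x ^ ?p) ` k) C id"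
    using insert.prems(2) insert.hyps(1)
      lindep_mono[OF is_subfield_power_image[OF k p] _ order_refl subset_insertI, of C id c0] by blast
  hence indepC: "\<not> lindep ?K C id" using insert.IH insert.prems(1) by blast
  note E = hs_fixed_powspan_self[OF k p sub]
  have "hs_fixed k \<subseteq> powspan k (?p ^ n) UNIV" for n
    using subset_powspan_iterate[OF k p E, of n] powspan_mono[of "hs_fixed k" UNIV k "?p ^ n"] by blast
  hence "hs_fixed k \<subseteq> perfect_core k UNIV" unfolding perfect_core_def by blast
  then obtain B where B: "finite B" "hs_fixed k \<subseteq> lspan k B"
    using perfect_core_finite[OF k p S] by blast
  show ?case
  proof
    assume "lindep ?K (insert c0 C) id"
    then obtain f where f: "\<And>c. f c \<in> ?K" "\<exists>c\<in>insert c0 C. f c \<noteq> 0" "f c0 * c0 + (\<Sum>c\<in>C. f c * c) = 0"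
      unfolding lindep_def using insert.hyps by auto
    have "f c0 \<noteq> 0"
    proof
      assume "f c0 = 0"
      hence "lindep ?K C id" using f unfolding lindep_def by auto
      with indepC show False by blast
    qed
    from f(1) obtain z where z: "\<And>c. f c = z c ^ ?p" by (auto simp: image_iff) metis
    define y where "y c = z c / z c0" for c
    have "z c0 \<noteq> 0" using \<open>f c0 \<noteq> 0\<close> prime_gt_0_nat[OF p] by (auto simp: z)
    have "c0 + (\<Sum>c\<in>C. c * y c ^ ?p) = (f c0 * c0 + (\<Sum>c\<in>C. f c * c)) / f c0"
      using \<open>f c0 \<noteq> 0\<close>
      by (simp add: y_def z power_divide add_divide_distrib sum_divide_distrib mult.commute)
    hence rel: "c0 + (\<Sum>c\<in>C. c * y c ^ ?p) = 0" by (simp add: f(3))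
    hence "- c0 = (\<Sum>c\<in>C. c * y c ^ ?p)" by (rule minus_unique)
    moreover have "- c0 \<in> hs_fixed k"
      using insert.prems(1) hs_fixed_base is_subfieldD(4)[OF k] by blast
    ultimately have "(\<Sum>c\<in>C. c * y c ^ ?p) \<in> hs_fixed k" by simp
    hence "y c \<in> hs_fixed k" if "c \<in> C" for c
      using insert.prems(1) that by (intro hs_fixed_coefficients[OF k p _ indepC, of y]) auto
    moreover have "y c0 = 1" using \<open>z c0 \<noteq> 0\<close> by (simp add: y_def)
    moreover from this have "y c0 \<in> hs_fixed k" using is_subfieldD(2)[OF is_subfield_hs_fixed[OF k]] by simp
    ultimately have "y c \<in> hs_fixed k" if "c \<in> insert c0 C" for c using that by blast
    moreover have "(\<Sum>c\<in>insert c0 C. c * y c ^ ?p) = 0"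
      using insert.hyps rel \<open>y c0 = 1\<close> by simp
    ultimately have "y c0 = 0"
      using insert.hyps(1)
      by (intro indep_powers_of_finite_extension[OF k p E B insert.prems, of y]) auto
    with \<open>y c0 = 1\<close> show False by simp
  qed
qed

section \<open>A derivation separating an element from a subfield\<close>

text \<open>As \<open>g\<close> does not vanish at \<open>z\<close>, the factor \<open>q\<close>
  must; cancelling one linear factor at a time leaves \<open>g\<close> dividing 1.\<close>

lemma poly_factor_power:
  fixes g q :: "'a::field poly"
  assumes "g * q = [:- z, 1:] ^ n" "poly g z \<noteq> 0"
  shows "degree g = 0"
  using assms(1)
proof (induction n arbitrary: q)
  case 0
  thus ?case by (metis dvd_triv_left is_unit_iff_degree power_0 zero_neq_one mult_zero_left)
next
  case (Suc n)
  have "poly (g * q) z = 0" unfolding Suc.prems by simp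
  hence "poly q z = 0" using assms(2) by simp
  then obtain q' where q': "q = [:- z, 1:] * q'" by (auto simp: poly_eq_0_iff_dvd elim: dvdE)
  have "[:- z, 1:] * (g * q') = [:- z, 1:] * [:- z, 1:] ^ n"
    using Suc.prems unfolding q' power_Suc by (simp only: mult.left_commute)
  hence "g * q' = [:- z, 1:] ^ n" by (subst (asm) mult_left_cancel) auto
  thus ?case by (rule Suc.IH)
qed

lemma linear_power_char:
  fixes z :: "'a::field"
  assumes "prime CHAR('a)"
  shows "[:- z, 1:] ^ CHAR('a) = monom 1 CHAR('a) - [:z ^ CHAR('a):]"
proof -
  have "[:- z, 1:] = monom 1 1 - [:z:]" by (simp add: monom_altdef)
  moreover have "prime CHAR('a poly)" using assms by simp
  ultimately show ?thesis
    using prime_char_diff_power[of "monom 1 1" "[:z:]"] by (simp add: monom_power poly_const_pow)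
qed

text \<open>A nonzero polynomial \<open>h\<close> of least degree vanishing at \<open>z\<close> has
  degree below \<open>p\<close>, so its derivative is nonzero and \<open>z\<close> is a simple root.
  But \<open>h\<close> divides \<open>X^p - z^p = (X - z)^p\<close>; hence \<open>h\<close> is
  linear and \<open>z\<close> lies in \<open>N\<close>.\<close>

lemma purely_inseparable_indep:
  fixes N :: "'a::field set"
  assumes N: "is_subfield N" and p: "prime CHAR('a)" and z: "z \<notin> N" "z ^ CHAR('a) \<in> N"
    and f: "f \<in> poly_over N" "degree f < CHAR('a)" "poly f z = 0"
  shows "f = 0"
proof (rule ccontr)
  let ?p = "CHAR('a)"
  let ?P = "\<lambda>f. f \<in> poly_over N \<and> f \<noteq> 0 \<and> poly f z = 0"
  note cl = poly_over_closed[OF N]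
  assume "f \<noteq> 0"
  define h where "h = arg_min degree ?P"
  have h: "?P h" unfolding h_def by (rule arg_min_natI[of ?P f]) (use f \<open>f \<noteq> 0\<close> in auto)
  have min: "degree h \<le> degree f" if "?P f" for f
    unfolding h_def using that by (rule arg_min_nat_le)
  define m where "m = degree h"
  have m: "m < ?p" using min[of f] f \<open>f \<noteq> 0\<close> by (auto simp: m_def)
  have "m \<noteq> 0"
  proof
    assume "m = 0"
    then obtain c where "h = [:c:]" using degree_eq_zeroE unfolding m_def by blast
    thus False using h by auto
  qed
  have coeff_h: "coeff h i \<in> N" for i using h by (auto simp: poly_over_def)
  \<comment> \<open>The leading coefficient survives differentiation because
    \<open>0 < m < p\<close>.\<close>
  have "coeff (pderiv h) (m - 1) = of_nat m * coeff h m"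
    using \<open>m \<noteq> 0\<close> by (simp add: coeff_pderiv)
  moreover have "of_nat m \<noteq> (0::'a)"
    using m \<open>m \<noteq> 0\<close> by (auto simp: of_nat_eq_0_iff_char_dvd dest: dvd_imp_le)
  ultimately have "pderiv h \<noteq> 0" using h by (auto simp: m_def)
  moreover have of_nat_N: "of_nat i \<in> N" for i
    by (induction i) (auto intro: is_subfieldD[OF N])
  hence "pderiv h \<in> poly_over N"
    by (auto simp: poly_over_def coeff_pderiv simp del: of_nat_Suc intro!: is_subfieldD(6)[OF N] coeff_h)
  moreover have "degree (pderiv h) < m"
    
    using \<open>m \<noteq> 0\<close> by (intro le_less_trans[OF degree_le[of "m - 1"]]) (auto simp: m_def coeff_pderiv coeff_eq_0)
  ultimately have simple: "poly (pderiv h) z \<noteq> 0" using min[of "pderiv h"] by (auto simp: m_def)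
  obtain g where g: "h = [:- z, 1:] * g" using h by (auto simp: poly_eq_0_iff_dvd elim: dvdE)
  have "poly (pderiv h) z = poly g z"
    unfolding g pderiv_mult by (simp add: pderiv_pCons)
  with simple have gz: "poly g z \<noteq> 0" by simp
  have "monom 1 ?p - [:z ^ ?p:] \<in> poly_over N"
    using z(2) is_subfieldD[OF N] by (intro cl) auto
  then obtain q r where qr: "q \<in> poly_over N" "r \<in> poly_over N" "monom 1 ?p - [:z ^ ?p:] = q * h + r"
    "\<And>i. i \<ge> degree h \<Longrightarrow> coeff r i = 0"
    using poly_over_division[OF N] h by metis
  have "r = 0"
  proof (rule ccontr)
    assume "r \<noteq> 0"
    have "poly r z = poly (q * h + r) z" using h by simp
    also have "\<dots> = 0" unfolding qr(3)[symmetric] by (simp add: poly_monom)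
    finally have "degree h \<le> degree r" using min[of r] qr(2) \<open>r \<noteq> 0\<close> by simp
    hence "coeff r (degree r) = 0" by (rule qr(4))
    with \<open>r \<noteq> 0\<close> show False by simp
  qed
  have pp: "?p = Suc (?p - 1)" using p by (simp add: prime_gt_0_nat)
  have "[:- z, 1:] * (g * q) = q * h" by (simp only: g mult_ac)
  also have "\<dots> = [:- z, 1:] ^ ?p" using qr(3) \<open>r = 0\<close> by (simp add: linear_power_char[OF p])
  also have "\<dots> = [:- z, 1:] * [:- z, 1:] ^ (?p - 1)" by (subst pp) simp
  finally have "g * q = [:- z, 1:] ^ (?p - 1)" by (subst (asm) mult_left_cancel) auto
  hence "degree g = 0" using gz by (rule poly_factor_power)
  then obtain c where c: "g = [:c:]" using degree_eq_zeroE by blast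
  have "c \<noteq> 0" using gz c by auto
  have "coeff h 0 = - z * c" "coeff h 1 = c" by (simp_all add: g c)
  hence "z = - (coeff h 0 / coeff h 1)" using \<open>c \<noteq> 0\<close> by simp
  also have "\<dots> \<in> N" by (intro is_subfieldD(4)[OF N] is_subfield_divide N coeff_h)
  finally show False using z(1) by simp
qed

text \<open>Zorn's lemma, as the union of a nonempty chain of subfields is a subfield. Maximality
  will give \<open>y \<in> N(z)\<close> for every \<open>z\<close> outside \<open>N\<close>.\<close>

lemma maximal_subfield_avoiding:
  fixes M :: "'a::field set"
  assumes "is_subfield M" "y \<notin> M"
  shows "\<exists>N. is_subfield N \<and> M \<subseteq> N \<and> y \<notin> N \<and> (\<forall>N'. is_subfield N' \<and> N \<subset> N' \<longrightarrow> y \<in> N')"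
proof -
  let ?A = "{N. is_subfield N \<and> M \<subseteq> N \<and> y \<notin> N}"
  have "\<exists>N\<in>?A. \<forall>X\<in>?A. N \<subseteq> X \<longrightarrow> X = N"
  proof (rule subset_Zorn_nonempty)
    show "?A \<noteq> {}" using assms by blast
    fix C assume C: "C \<noteq> {}" "subset.chain ?A C"
    have sf: "is_subfield X" "M \<subseteq> X" "y \<notin> X" if "X \<in> C" for X
      using C(2) that by (auto simp: subset.chain_def)
    have pair: "\<exists>X\<in>C. a \<in> X \<and> b \<in> X" if "a \<in> \<Union>C" "b \<in> \<Union>C" for a b
    proof -
      from that obtain X Y where "X \<in> C" "a \<in> X" "Y \<in> C" "b \<in> Y" by blast
      moreover from this have "X \<subseteq> Y \<or> Y \<subseteq> X" using C(2) by (auto simp: subset_chain_def)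
      ultimately show ?thesis by blast
    qed
    have "is_subfield (\<Union>C)"
    proof (rule is_subfieldI)
      obtain X where "X \<in> C" using C(1) by blast
      thus "1 \<in> \<Union>C" using is_subfieldD(2)[OF sf(1)] by (intro UnionI)
      show "a - b \<in> \<Union>C" "a * b \<in> \<Union>C" if ab: "a \<in> \<Union>C" "b \<in> \<Union>C" for a b
      proof -
        obtain X where X: "X \<in> C" "a \<in> X" "b \<in> X" using pair[OF ab] by blast
        thus "a - b \<in> \<Union>C" "a * b \<in> \<Union>C"
          using is_subfieldD(5,6)[OF sf(1)[OF X(1)] X(2,3)] by (auto intro: UnionI[OF X(1)])
      qed
      show "inverse a \<in> \<Union>C" if a: "a \<in> \<Union>C" for a
      proof -
        obtain X where X: "X \<in> C" "a \<in> X" using a by (rule UnionE)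
        thus ?thesis using is_subfield_inverse[OF sf(1)[OF X(1)] X(2)] by (intro UnionI)
      qed
    qed
    moreover obtain X where "X \<in> C" using C(1) by blast
    ultimately show "\<Union>C \<in> ?A" using sf(2,3) by blast
  qed
  then obtain N where N: "is_subfield N" "M \<subseteq> N" "y \<notin> N" and max: "\<forall>X\<in>?A. N \<subseteq> X \<longrightarrow> X = N" by blast
  have "y \<in> N'" if "is_subfield N'" "N \<subset> N'" for N'
  proof (rule ccontr)
    assume "y \<notin> N'"
    hence "N' \<in> ?A" using that N(2) by auto
    thus False using max that(2) by auto
  qed
  thus ?thesis using N by (intro exI[of _ N]) auto
qed

lemma DerD:
  assumes "\<delta> \<in> Der k"
  shows "\<delta> (a + b) = \<delta> a + \<delta> b" "\<delta> (a * b) = a * \<delta> b + b * \<delta> a" "c \<in> k \<Longrightarrow> \<delta> c = 0"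
proof -
  have *: "\<delta> (x + y) = \<delta> x + \<delta> y" "\<delta> (x * y) = x * \<delta> y + y * \<delta> x"
    "c \<in> k \<Longrightarrow> \<delta> (c * x) = c * \<delta> x" for x y c
    using assms unfolding Der_def linear_over_def by blast+
  show "\<delta> (a + b) = \<delta> a + \<delta> b" "\<delta> (a * b) = a * \<delta> b + b * \<delta> a" by (fact *)+
  have "\<delta> 1 = 0" using *(2)[of 1 1] by simp
  thus "\<delta> c = 0" if "c \<in> k" using *(3)[OF that, of 1] by simp
qed

lemma DerI:
  assumes "\<And>a b. \<delta> (a + b) = \<delta> a + \<delta> b" "\<And>a b. \<delta> (a * b) = a * \<delta> b + b * \<delta> a"
    "\<And>c. c \<in> k \<Longrightarrow> \<delta> c = 0"
  shows "\<delta> \<in> Der k"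
  unfolding Der_def linear_over_def by (simp add: assms)

text \<open>Over a maximal subfield \<open>N\<close> avoiding \<open>y\<close>, every element is a
  polynomial in \<open>y\<close>, and \<open>y^p \<in> N\<close>. Formal differentiation of these
  polynomials is well defined because \<open>X^p - y^p\<close> has derivative 0; it sends
  \<open>y\<close> to 1 and kills \<open>N\<close>.\<close>

lemma derivation_separating:
  fixes M :: "'a::field set"
  assumes M: "is_subfield M" and p: "prime CHAR('a)" and pM: "\<And>x. x ^ CHAR('a) \<in> M" and y: "y \<notin> M"
  shows "\<exists>\<delta>\<in>Der M. \<delta> y = 1"
proof -
  let ?p = "CHAR('a)"
  obtain N where N: "is_subfield N" "M \<subseteq> N" "y \<notin> N" "\<And>N'. is_subfield N' \<Longrightarrow> N \<subset> N' \<Longrightarrow> y \<in> N'"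
    using maximal_subfield_avoiding[OF M y] by blast
  note cl = poly_over_closed[OF N(1)]
  have p0: "?p > 0" using p by (simp add: prime_gt_0_nat)
  have pN: "x ^ ?p \<in> N" for x using pM N(2) by blast
  define F where "F z = monom 1 ?p - [:z ^ ?p:]" for z :: 'a
  have F: "F z \<in> poly_over N" "poly (F z) z = 0" "pderiv (F z) = 0" for z
    using pN is_subfieldD[OF N(1)]
    by (auto simp: F_def poly_monom pderiv_diff pderiv_monom pderiv_pCons intro!: cl)
  have degF: "degree (F z) = ?p" for z
    using degree_linear_power[of "- z" ?p] by (simp add: F_def flip: linear_power_char[OF p])
  hence F0: "F z \<noteq> 0" for z using p0 by (metis degree_0 less_irrefl)
  \<comment> \<open>For \<open>z\<close> outside \<open>N\<close>, \<open>y\<close> lies in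
    \<open>N(z)\<close>, which is spanned by \<open>p\<close> elements. So
    \<open>1, y, ..., y^(p-1), z\<close> are dependent, and \<open>z\<close> must occur because
    these powers of \<open>y\<close> are independent.\<close>
  have rep: "\<exists>f\<in>poly_over N. poly f y = z" for z
  proof (cases "z \<in> N")
    case True
    thus ?thesis by (intro bexI[of _ "[:z:]"]) (auto intro: cl)
  next
    case False
    have "is_subfield (adjoin N z)" "N \<subset> adjoin N z"
      using is_subfield_adjoin[OF N(1)] adjoin_base[OF N(1)] adjoin_self[OF N(1), of z] False by auto
    hence y_in: "y \<in> adjoin N z" and adj: "is_subfield (adjoin N z)" using N(4) by blast+
    let ?B = "(\<lambda>i. z ^ i) ` {..<?p}"
    have span: "adjoin N z \<subseteq> lspan N ?B"
      using adjoin_algebraic[OF N(1) F(1) F0 F(2), of z] by (simp add: degF)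
    \<comment> \<open>Index \<open>p\<close> carries \<open>z\<close> in place of
      \<open>y^p\<close>, giving \<open>p + 1\<close> vectors.\<close>
    define v where "v i = (if i < ?p then y ^ i else z)" for i
    have "card ?B < card {..?p}" using card_image_le[of "{..<?p}" "\<lambda>i. z ^ i"] by simp
    moreover have "v i \<in> lspan N ?B" for i
      using span is_subfieldD(7)[OF adj y_in] adjoin_self[OF N(1), of z] by (auto simp: v_def)
    ultimately have "lindep N {..?p} v" by (intro lindep_by_card[OF N(1), of ?B]) auto
    then obtain f i where f: "\<And>i. f i \<in> N" "i \<in> {..?p}" "f i \<noteq> 0" "(\<Sum>i\<in>{..?p}. f i * v i) = 0"
      unfolding lindep_def by blast
    define g where "g = (\<Sum>i<?p. monom (f i) i)"
    have g: "g \<in> poly_over N" unfolding g_def using f(1) by (intro cl)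
    have coeff_g: "coeff g i = (if i < ?p then f i else 0)" for i
      by (simp add: g_def coeff_sum)
    have "{..?p} = insert ?p {..<?p}" by auto
    hence rel: "f ?p * z + poly g y = 0"
      using f(4) by (simp add: g_def poly_sum poly_monom v_def)
    have "f ?p \<noteq> 0"
    proof
      assume fp: "f ?p = 0"
      have "degree g < ?p"
        using p0 coeff_g by (metis (no_types, lifting) degree_0 leading_coeff_0_iff)
      hence "g = 0"
        using purely_inseparable_indep[OF N(1) p N(3) pN g] rel fp by simp
      hence "f i = 0" if "i < ?p" for i using coeff_g[of i] that by simp
      thus False using f(2,3) fp by (cases "i = ?p") auto
    qed
    hence "z = poly (smult (- (1 / f ?p)) g) y"
      using rel by (simp add: field_simps eq_neg_iff_add_eq_0)
    moreover have "smult (- (1 / f ?p)) g \<in> poly_over N"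
      by (intro cl g is_subfieldD(4)[OF N(1)] is_subfield_divide N(1) f(1) is_subfieldD(2)[OF N(1)])
    ultimately show ?thesis by metis
  qed
  \<comment> \<open>Well-definedness of the derivation: a polynomial over \<open>N\<close> vanishing
    at \<open>y\<close> is a multiple of \<open>F y\<close>, which has derivative 0 and vanishes at
    \<open>y\<close>.\<close>
  have zero: "poly (pderiv f) y = 0" if f: "f \<in> poly_over N" "poly f y = 0" for f
  proof -
    obtain q r where qr: "r \<in> poly_over N" "f = q * F y + r" "\<And>i. i \<ge> ?p \<Longrightarrow> coeff r i = 0"
      using poly_over_division[OF N(1) F(1)[of y] F0 f(1)] unfolding degF by blast
    have "poly r y = 0" using f(2) F(2) by (simp add: qr(2))
    moreover have "degree r < ?p"
      using p0 qr(3) by (metis degree_0 leading_coeff_0_iff not_less)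
    ultimately have "r = 0" by (intro purely_inseparable_indep[OF N(1) p N(3) pN qr(1)])
    thus ?thesis by (simp add: qr(2) pderiv_mult F)
  qed
  obtain G where G: "\<And>z. G z \<in> poly_over N" "\<And>z. poly (G z) y = z" using rep by metis
  define \<delta> where "\<delta> z = poly (pderiv (G z)) y" for z
  have \<delta>: "\<delta> (poly f y) = poly (pderiv f) y" if "f \<in> poly_over N" for f
    using zero[of "G (poly f y) - f"] that G by (simp add: \<delta>_def cl pderiv_diff)
  have "\<delta> \<in> Der M"
  proof (rule DerI)
    show "\<delta> (a + b) = \<delta> a + \<delta> b" for a b
      using \<delta>[of "G a + G b"] G by (simp add: cl pderiv_add \<delta>_def[of a] \<delta>_def[of b])
    show "\<delta> (a * b) = a * \<delta> b + b * \<delta> a" for a b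
      using \<delta>[of "G a * G b"] G by (simp add: cl pderiv_mult \<delta>_def[of a] \<delta>_def[of b])
    show "\<delta> a = 0" if "a \<in> M" for a
      using \<delta>[of "[:a:]"] that N(2) by (simp add: cl subset_iff)
  qed
  moreover have "\<delta> y = 1"
    using \<delta>[of "[:0, 1:]"] is_subfieldD(1,2)[OF N(1)] by (simp add: cl pderiv_pCons)
  ultimately show ?thesis by blast
qed

section \<open>Derivations of a domain and of its quotient field\<close>

abbreviation to_fract :: "'a::idom \<Rightarrow> 'a fract" where
  "to_fract r \<equiv> Fract r 1"

lemma to_fract_simps:
  fixes x y :: "'a::idom" and f :: "'i \<Rightarrow> 'a"
  shows "to_fract (x + y) = to_fract x + to_fract y" "to_fract (x - y) = to_fract x - to_fract y"
  "to_fract (x * y) = to_fract x * to_fract y" "to_fract 0 = 0" "to_fract 1 = 1"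
  "to_fract x = to_fract y \<longleftrightarrow> x = y"
  "to_fract (x ^ n) = to_fract x ^ n" "to_fract (sum f I) = (\<Sum>i\<in>I. to_fract (f i))"
proof -
  show plus: "to_fract (x + y) = to_fract x + to_fract y" and "to_fract (x - y) = to_fract x - to_fract y"
    and mult: "to_fract (x * y) = to_fract x * to_fract y" and 0: "to_fract 0 = 0" and 1: "to_fract 1 = 1"
    and "to_fract x = to_fract y \<longleftrightarrow> x = y" for x y :: 'a
    by (simp_all add: Zero_fract_def One_fract_def eq_fract)
  show "to_fract (x ^ n) = to_fract x ^ n" by (induction n) (simp_all add: 1 mult del: mult_fract)
  show "to_fract (sum f I) = (\<Sum>i\<in>I. to_fract (f i))"
    by (induction I rule: infinite_finite_induct) (simp_all add: 0 plus del: add_fract)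
qed

lemma to_fract_quotient:
  obtains a b where "b \<noteq> 0" "x * to_fract b = to_fract a"
proof (cases x rule: Fract_cases)
  case (Fract a b)
  thus ?thesis by (intro that[of b a]) (auto simp: eq_fract)
qed

lemma CHAR_fract: "CHAR('a::idom fract) = CHAR('a)"
  by (rule CHAR_eqI) (auto simp: of_nat_fract Zero_fract_def eq_fract of_nat_eq_0_iff_char_dvd)

lemma is_subfield_to_fract:
  assumes "is_subfield k"
  shows "is_subfield (to_fract ` k)"
proof (rule is_subfieldI)
  note sf = is_subfieldD[OF assms]
  show "1 \<in> to_fract ` k" unfolding One_fract_def by (intro imageI sf)
  fix a assume "a \<in> to_fract ` k"
  then obtain x where x: "x \<in> k" "a = to_fract x" by blast
  show "inverse a \<in> to_fract ` k" if "a \<noteq> 0"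
  proof -
    have "x \<noteq> 0" using that by (auto simp: x(2) to_fract_simps)
    then obtain y where y: "y \<in> k" "x * y = 1" using sf(9)[OF x(1)] by blast
    hence "a * to_fract y = 1" by (simp add: x(2) to_fract_simps)
    thus ?thesis using y(1) by (auto simp: inverse_unique)
  qed
  fix b assume "b \<in> to_fract ` k"
  then obtain y where y: "y \<in> k" "b = to_fract y" by blast
  show "a - b \<in> to_fract ` k" "a * b \<in> to_fract ` k"
    unfolding x(2) y(2) to_fract_simps(2,3)[symmetric] by (intro imageI sf x(1) y(1))+
qed

text \<open>For \<open>b \<noteq> 0\<close> the series \<open>\<phi> b\<close> has nonzero constant
  term and is therefore a unit over \<open>Q(R)\<close>, so \<open>\<phi>\<close> extends to
  fractions by \<open>\<phi> a / \<phi> b\<close>.\<close>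

lemma HS_derivation_hs_hom:
  fixes k :: "'a::idom set"
  assumes k: "is_subfield k" and D: "HS_derivation k D"
  shows "\<exists>\<Phi>. hs_hom (to_fract ` k) \<Phi> \<and> (\<forall>r n. fps_nth (\<Phi> (to_fract r)) n = to_fract (D n r))"
proof -
  define \<phi> where "\<phi> r = Abs_fps (\<lambda>n. to_fract (D n r))" for r
  have lin: "D n (x + y) = D n x + D n y" "c \<in> k \<Longrightarrow> D n (c * x) = c * D n x" for n x y c
    using D unfolding HS_derivation_def linear_over_def by auto
  have D0: "D 0 r = r" for r using D unfolding HS_derivation_def by simp
  have leib: "D n (x * y) = (\<Sum>i=0..n. D i x * D (n - i) y)" for n x y
  proof -
    have "{(i, j). i + j = n} = (\<lambda>i. (i, n - i)) ` {0..n}" by (auto simp: image_iff)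
    moreover have "inj_on (\<lambda>i. (i, n - i)) {0..n}" by (auto simp: inj_on_def)
    ultimately show ?thesis using D unfolding HS_derivation_def by (simp add: sum.reindex)
  qed
  have add: "\<phi> (x + y) = \<phi> x + \<phi> y" for x y
    by (rule fps_ext) (simp add: \<phi>_def lin to_fract_simps(1) del: add_fract)
  have mult: "\<phi> (x * y) = \<phi> x * \<phi> y" for x y
    by (rule fps_ext) (simp add: \<phi>_def leib fps_mult_nth to_fract_simps(3,8) del: mult_fract)
  have nth0: "fps_nth (\<phi> r) 0 = to_fract r" for r by (simp add: \<phi>_def D0)
  have nz: "\<phi> r \<noteq> 0" if "r \<noteq> 0" for r
  proof
    assume "\<phi> r = 0"
    hence "to_fract r = to_fract 0" using nth0[of r] by (simp add: to_fract_simps)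
    thus False using that by (simp only: to_fract_simps(6))
  qed
  have one: "\<phi> 1 = 1" using mult[of 1 1] nz[of 1] by simp
  have const: "\<phi> c = fps_const (to_fract c)" if "c \<in> k" for c
  proof -
    have "\<phi> (c * 1) = fps_const (to_fract c) * \<phi> 1"
      by (rule fps_ext, simp only: \<phi>_def lin(2)[OF that]) (simp add: to_fract_simps(3) del: mult_fract)
    thus ?thesis by (simp add: one)
  qed
  have inv: "\<phi> b * inverse (\<phi> b) = 1" if "b \<noteq> 0" for b
  proof -
    have "fps_nth (\<phi> b) 0 \<noteq> 0" using that by (simp add: nth0 Zero_fract_def eq_fract)
    thus ?thesis by (simp add: inverse_mult_eq_1')
  qed
  \<comment> \<open>One value \<open>z\<close> serves all representations \<open>a / b\<close> of
    \<open>x\<close>, so later steps may use whichever is convenient.\<close>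
  have "\<exists>z. \<forall>a b. b \<noteq> 0 \<and> x * to_fract b = to_fract a \<longrightarrow> z * \<phi> b = \<phi> a" for x
  proof -
    obtain a b where ab: "b \<noteq> 0" "x * to_fract b = to_fract a" by (rule to_fract_quotient)
    have "\<phi> a * inverse (\<phi> b) * \<phi> d = \<phi> c" if "d \<noteq> 0" "x * to_fract d = to_fract c" for c d
    proof -
      have "to_fract (a * d) = to_fract (c * b)"
        unfolding to_fract_simps(3) ab(2)[symmetric] that(2)[symmetric] by (simp only: mult_ac)
      hence "\<phi> a * \<phi> d = \<phi> c * \<phi> b" by (simp only: to_fract_simps(6) flip: mult)
      hence "\<phi> a * inverse (\<phi> b) * \<phi> d = \<phi> c * (\<phi> b * inverse (\<phi> b))" by (simp add: mult_ac)
      thus ?thesis by (simp add: inv ab(1))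
    qed
    thus ?thesis by blast
  qed
  then obtain \<Phi> where \<Phi>: "\<And>x a b. b \<noteq> 0 \<Longrightarrow> x * to_fract b = to_fract a \<Longrightarrow> \<Phi> x * \<phi> b = \<phi> a"
    by metis
  have eq: "z = \<Phi> x" if "b \<noteq> 0" "x * to_fract b = to_fract a" "z * \<phi> b = \<phi> a" for x z a b
    using \<Phi>[OF that(1,2)] that(3) nz[OF that(1)] by (metis mult_right_cancel)
  have \<Phi>_to_fract: "\<Phi> (to_fract r) = \<phi> r" for r
    by (rule eq[symmetric, of 1 _ r]) (simp_all add: one)
  have "hs_hom (to_fract ` k) \<Phi>"
    unfolding hs_hom_def
  proof (intro conjI allI ballI)
    fix x y :: "'a fract"
    obtain a b where x: "b \<noteq> 0" "x * to_fract b = to_fract a" by (rule to_fract_quotient)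
    obtain c d where y: "d \<noteq> 0" "y * to_fract d = to_fract c" by (rule to_fract_quotient)
    note \<Phi>x = \<Phi>[OF x] and \<Phi>y = \<Phi>[OF y]
    show "\<Phi> (x + y) = \<Phi> x + \<Phi> y"
    proof (rule eq[symmetric, of "b * d" _ "a * d + c * b"])
      show "(x + y) * to_fract (b * d) = to_fract (a * d + c * b)"
        unfolding to_fract_simps(1,3) x(2)[symmetric] y(2)[symmetric] by (simp only: ring_distribs mult_ac)
      show "(\<Phi> x + \<Phi> y) * \<phi> (b * d) = \<phi> (a * d + c * b)"
        unfolding add mult \<Phi>x[symmetric] \<Phi>y[symmetric] by (simp only: ring_distribs mult_ac)
    qed (use x y in auto)
    show "\<Phi> (x * y) = \<Phi> x * \<Phi> y"
    proof (rule eq[symmetric, of "b * d" _ "a * c"])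
      show "x * y * to_fract (b * d) = to_fract (a * c)"
        unfolding to_fract_simps(3) x(2)[symmetric] y(2)[symmetric] by (simp only: mult_ac)
      show "\<Phi> x * \<Phi> y * \<phi> (b * d) = \<phi> (a * c)"
        unfolding mult \<Phi>x[symmetric] \<Phi>y[symmetric] by (simp only: mult_ac)
    qed (use x y in auto)
    have "fps_nth (\<Phi> x) 0 * to_fract b = x * to_fract b"
      using arg_cong[OF \<Phi>x, of "\<lambda>f. fps_nth f 0"] x(2) by (simp add: nth0)
    moreover have "to_fract b \<noteq> 0" using x(1) by (simp add: Zero_fract_def eq_fract)
    ultimately show "fps_nth (\<Phi> x) 0 = x" by (metis mult_right_cancel)
  next
    fix c assume "c \<in> to_fract ` k"
    thus "\<Phi> c = fps_const c" using \<Phi>_to_fract const by auto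
  qed
  moreover have "fps_nth (\<Phi> (to_fract r)) n = to_fract (D n r)" for r n
    by (simp add: \<Phi>_to_fract) (simp add: \<phi>_def)
  ultimately show ?thesis by blast
qed

section \<open>Denominators of derivations into the quotient field\<close>

lemma common_denominator:
  fixes w :: "nat \<Rightarrow> 'a::idom fract"
  shows "\<exists>u\<noteq>0. \<forall>i<n. \<exists>s. to_fract u * w i = to_fract s"
proof (induction n)
  case 0
  thus ?case by (intro exI[of _ 1]) auto
next
  case (Suc n)
  then obtain u where u: "u \<noteq> 0" "\<And>i. i < n \<Longrightarrow> \<exists>s. to_fract u * w i = to_fract s" by blast
  obtain a b where ab: "b \<noteq> 0" "w n * to_fract b = to_fract a" by (rule to_fract_quotient)
  have "\<exists>s. to_fract (b * u) * w i = to_fract s" if "i < Suc n" for i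
  proof (cases "i = n")
    case True
    have "to_fract (b * u) * w i = to_fract (u * a)"
      unfolding to_fract_simps(3) ab(2)[symmetric] True by (simp only: mult_ac)
    thus ?thesis by blast
  next
    case False
    then obtain s where "to_fract u * w i = to_fract s" 
      using u(2)[of i] \<open>i < Suc n\<close> by auto
    hence "to_fract (b * u) * w i = to_fract (b * s)" unfolding to_fract_simps(3) by (simp only: mult.assoc)
    thus ?thesis by blast
  qed
  thus ?case using u(1) ab(1) by (intro exI[of _ "b * u"]) auto
qed

text \<open>The \<open>\<omega> i\<close> represent the images of the basis vectors of
  \<open>R^n\<close> under the presentation. Membership in the relations replaces equality of
  classes, so that linear maps killing the relations can be applied directly.\<close>

lemma kaehler_finite_generators:
  assumes "kaehler_finitely_presented k"
  shows "\<exists>(n::nat) \<omega>. \<forall>r. \<exists>a. dsym r - (\<Sum>i<n. fscale (a i) (\<omega> i)) \<in> kaehler_relations k"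
proof -
  let ?N = "kaehler_relations k"
  let ?cl = "\<lambda>x. cong_mod ?N `` {x}"
  have N: "free.subspace ?N" unfolding kaehler_relations_def by (rule free.subspace_span)
  obtain n :: nat and \<phi> where
    add: "\<And>x y. x \<in> free_on {..<n} \<Longrightarrow> y \<in> free_on {..<n} \<Longrightarrow> \<phi> (x + y) = quot_add ?N (\<phi> x) (\<phi> y)" and
    scale: "\<And>a x. x \<in> free_on {..<n} \<Longrightarrow> \<phi> (fscale a x) = quot_scale fscale ?N a (\<phi> x)" and
    img: "\<phi> ` free_on {..<n} = kaehler_differentials k"
    using assms unfolding kaehler_finitely_presented_def finitely_presented_def
    by (elim exE conjE) (rule that, simp_all)
  have single: "Poly_Mapping.single i 1 \<in> free_on {..<n}" if "i < n" for i
    using that by (auto simp: free_on_def)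
  have "\<exists>w. \<phi> x = ?cl w" if "x \<in> free_on {..<n}" for x
    using img that unfolding kaehler_differentials_def quotient_def by blast
  then obtain W where W: "\<And>x. x \<in> free_on {..<n} \<Longrightarrow> \<phi> x = ?cl (W x)" by metis
  define \<omega> where "\<omega> i = W (Poly_Mapping.single i 1)" for i
  have free: "(\<Sum>i\<in>J. fscale (a i) (Poly_Mapping.single i 1)) \<in> free_on {..<n}" if "J \<subseteq> {..<n}" for J a
    unfolding free_on_def
  proof (intro CollectI subsetI, rule ccontr)
    fix j assume j: "j \<in> Poly_Mapping.keys (\<Sum>i\<in>J. fscale (a i) (Poly_Mapping.single i 1))" "j \<notin> {..<n}"
    hence "i \<noteq> j" if "i \<in> J" for i using that \<open>J \<subseteq> {..<n}\<close> by auto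
    hence "Poly_Mapping.lookup (\<Sum>i\<in>J. fscale (a i) (Poly_Mapping.single i 1)) j = 0"
      unfolding lookup_sum by (intro sum.neutral) (simp add: lookup_single)
    with j(1) show False by (simp add: in_keys_iff)
  qed
  have comb: "\<phi> (\<Sum>i\<in>J. fscale (a i) (Poly_Mapping.single i 1)) = ?cl (\<Sum>i\<in>J. fscale (a i) (\<omega> i))"
    if "finite J" "J \<subseteq> {..<n}" for J a
    using that
  proof (induction J rule: finite_induct)
    case empty
    have 0: "0 \<in> free_on {..<n}" by (simp add: free_on_def)
    have "\<phi> (fscale 0 0) = quot_scale fscale ?N 0 (?cl (W 0))" unfolding scale[OF 0] W[OF 0] ..
    thus ?case by (simp add: free.quot_scale_class[OF N])
  next
    case (insert i J)
    have i: "i < n" using insert.prems by auto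
    have "fscale (a i) (Poly_Mapping.single i 1) \<in> free_on {..<n}" using free[of "{i}" a] i by simp
    thus ?case
      using insert i free[of J a]
      by (simp add: add scale[OF single] W[OF single] free.quot_scale_class[OF N] free.quot_add_class[OF N] \<omega>_def)
  qed
  have "\<exists>a. dsym r - (\<Sum>i<n. fscale (a i) (\<omega> i)) \<in> ?N" for r
  proof -
    have "?cl (dsym r) \<in> \<phi> ` free_on {..<n}"
      unfolding img kaehler_differentials_def by (rule quotientI) simp
    then obtain x where x: "x \<in> free_on {..<n}" "?cl (dsym r) = \<phi> x" by blast
    let ?a = "Poly_Mapping.lookup x"
    have "x = (\<Sum>i<n. fscale (?a i) (Poly_Mapping.single i 1))"
    proof (rule poly_mapping_eqI)
      fix j
      show "Poly_Mapping.lookup x j = Poly_Mapping.lookup (\<Sum>i<n. fscale (?a i) (Poly_Mapping.single i 1)) j"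
        using x(1) by (auto simp: lookup_sum lookup_single when_def free_on_def in_keys_iff subset_iff if_distrib cong: if_cong)
    qed
    hence "\<phi> x = ?cl (\<Sum>i<n. fscale (?a i) (\<omega> i))" using comb[of "{..<n}" ?a] by simp
    hence "(dsym r, \<Sum>i<n. fscale (?a i) (\<omega> i)) \<in> cong_mod ?N"
      using x(2) eq_equiv_class_iff[OF free.equiv_cong_mod[OF N]] by simp
    thus ?thesis by (auto simp: cong_mod_def)
  qed
  thus ?thesis by (intro exI[of _ n] exI[of _ \<omega>]) blast
qed

text \<open>The image of \<open>R\<close> under a derivation into \<open>Q(R)\<close> lies in a finitely generated \<open>R\<close>-submodule,
  because \<open>\<Omega>\<^sub>R\<^sub>/\<^sub>k\<close> is finitely generated.\<close>

lemma derivation_common_denominator: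
  fixes k :: "'a::idom set" and d :: "'a \<Rightarrow> 'a fract"
  assumes "kaehler_finitely_presented k"
    and d: "\<And>r s. d (r + s) = d r + d s" "\<And>r s. d (r * s) = to_fract r * d s + to_fract s * d r"
      "\<And>c. c \<in> k \<Longrightarrow> d c = 0"
  shows "\<exists>u\<noteq>0. \<forall>r. \<exists>s. to_fract u * d r = to_fract s"
proof -
  \<comment> \<open>The linear extension of \<open>d\<close> to the free module on the symbols
    \<open>dsym r\<close>; it kills the Kaehler relations (\<open>ev_rel\<close>) and so represents
    the map on differentials induced by \<open>d\<close>.\<close>
  define ev where "ev f = (\<Sum>s\<in>Poly_Mapping.keys f. to_fract (Poly_Mapping.lookup f s) * d s)" for f :: "'a \<Rightarrow>\<^sub>0 'a"
  have ev: "ev f = (\<Sum>s\<in>A. to_fract (Poly_Mapping.lookup f s) * d s)"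
    if "finite A" "Poly_Mapping.keys f \<subseteq> A" for f A
    unfolding ev_def by (rule sum.mono_neutral_left) (use that in \<open>auto simp: in_keys_iff to_fract_simps\<close>)
  have ev_add: "ev (f + g) = ev f + ev g" for f g
  proof -
    let ?A = "Poly_Mapping.keys f \<union> Poly_Mapping.keys g"
    have "Poly_Mapping.keys (f + g) \<subseteq> ?A" by (rule Poly_Mapping.keys_add)
    thus ?thesis
      by (simp add: ev[of ?A] lookup_add to_fract_simps(1) ring_distribs sum.distrib del: add_fract)
  qed
  have ev_scale: "ev (fscale a f) = to_fract a * ev f" for a f
  proof -
    have "Poly_Mapping.keys (fscale a f) \<subseteq> Poly_Mapping.keys f" by (auto simp: in_keys_iff)
    thus ?thesis
      by (simp add: ev[of "Poly_Mapping.keys f"] to_fract_simps(3) sum_distrib_left mult.assoc del: mult_fract)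
  qed
  have ev_0: "ev 0 = 0" by (simp add: ev_def)
  have ev_diff: "ev (f - g) = ev f - ev g" for f g using ev_add[of "f - g" g] by simp
  have ev_dsym: "ev (dsym r) = d r" for r by (simp add: ev_def to_fract_simps)
  have ev_sum: "ev (sum f I) = (\<Sum>i\<in>I. ev (f i))" for f :: "nat \<Rightarrow> 'a \<Rightarrow>\<^sub>0 'a" and I
    by (induction I rule: infinite_finite_induct) (simp_all add: ev_0 ev_add)
  have ev_rel: "ev f = 0" if "f \<in> kaehler_relations k" for f
    using that unfolding kaehler_relations_def
  proof (induction rule: free.span_induct)
    case base
    show ?case by (auto simp: free.subspace_def ev_0 ev_add ev_scale)
  next
    case (step f)
    thus ?case by (elim UnE CollectE exE conjE) (simp_all add: ev_diff ev_dsym ev_scale d)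
  qed
  obtain n :: nat and \<omega> where \<omega>: "\<And>r. \<exists>a. dsym r - (\<Sum>i<n. fscale (a i) (\<omega> i)) \<in> kaehler_relations k"
    using kaehler_finite_generators[OF assms(1)] by metis
  obtain u where u: "u \<noteq> 0" "\<And>i. i < n \<Longrightarrow> \<exists>s. to_fract u * ev (\<omega> i) = to_fract s"
    using common_denominator[of n "\<lambda>i. ev (\<omega> i)"] by blast
  then obtain s where s: "\<And>i. i < n \<Longrightarrow> to_fract u * ev (\<omega> i) = to_fract (s i)" by metis
  have "\<exists>t. to_fract u * d r = to_fract t" for r
  proof -
    obtain a where "dsym r - (\<Sum>i<n. fscale (a i) (\<omega> i)) \<in> kaehler_relations k" using \<omega> by blast
    hence "d r = (\<Sum>i<n. to_fract (a i) * ev (\<omega> i))"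
      using ev_rel by (fastforce simp: ev_diff ev_dsym ev_sum ev_scale)
    hence "to_fract u * d r = (\<Sum>i<n. to_fract (a i) * (to_fract u * ev (\<omega> i)))"
      by (simp only: sum_distrib_left mult.left_commute)
    also have "\<dots> = to_fract (\<Sum>i<n. a i * s i)"
      unfolding to_fract_simps(3,8) by (intro sum.cong refl) (simp only: s lessThan_iff)
    finally show ?thesis by blast
  qed
  thus ?thesis using u(1) by blast
qed

text \<open>For \<open>y\<close> in \<open>E\<close> outside \<open>k(L^p)\<close>, take
  \<open>\<delta>\<close> with \<open>\<delta> y = 1\<close> that kills \<open>k(L^p)\<close>, and a
  multiple \<open>u * \<delta>\<close> mapping \<open>R\<close> to \<open>R\<close>. It restricts to
  an integrable derivation of \<open>R\<close>; the resulting \<open>\<Phi>\<close> fixes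
  \<open>y\<close> but would have first-order term \<open>u \<noteq> 0\<close> there.\<close>

lemma hs_fixed_subset_powspan:
  fixes k :: "'a::idom set"
  assumes k: "is_subfield k" and p: "prime CHAR('a)" and "kaehler_finitely_presented k"
    and int: "Der k \<subseteq> IDer k"
  shows "hs_fixed (to_fract ` k) \<subseteq> powspan (to_fract ` k) CHAR('a) UNIV"
proof (rule subsetI, rule ccontr)
  let ?k = "to_fract ` k" and ?p = "CHAR('a)"
  let ?M = "powspan ?k ?p UNIV"
  have k': "is_subfield ?k" by (rule is_subfield_to_fract[OF k])
  have pc: "CHAR('a fract) = ?p" by (rule CHAR_fract)
  fix y assume y: "y \<in> hs_fixed ?k" "y \<notin> ?M"
  have M: "is_subfield ?M"
    by (rule is_subfield_powspan[OF k' is_subfield_UNIV]) (use p in \<open>auto simp: prime_gt_0_nat\<close>)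
  have pr: "prime CHAR('a fract)" using p by (simp add: pc)
  have pM: "x ^ CHAR('a fract) \<in> ?M" for x
    unfolding pc by (rule powspan_base[OF k']) simp
  obtain \<delta> where \<delta>_Der: "\<delta> \<in> Der ?M" and \<delta>_y: "\<delta> y = 1"
    using derivation_separating[OF M pr pM y(2)] by blast
  note \<delta> = DerD[OF \<delta>_Der]
  have kM: "c \<in> ?M" if "c \<in> ?k" for c
    by (rule subsetD[OF powspan_scalars[OF is_subfield_UNIV] that])
  have "\<exists>u\<noteq>0. \<forall>r. \<exists>s. to_fract u * \<delta> (to_fract r) = to_fract s"
    by (rule derivation_common_denominator[OF assms(3)])
       (use \<delta> kM in \<open>auto simp: to_fract_simps(1,3) simp del: add_fract mult_fract\<close>)
  then obtain u D where u: "u \<noteq> 0" "\<And>r. to_fract u * \<delta> (to_fract r) = to_fract (D r)" by metis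
  have "D \<in> Der k"
  proof (rule DerI)
    show "D (x + y) = D x + D y" for x y
    proof -
      have "to_fract (D (x + y)) = to_fract (D x + D y)"
        unfolding to_fract_simps(1) u(2)[symmetric] by (simp only: \<delta>(1) distrib_left)
      thus ?thesis by (simp only: to_fract_simps(6))
    qed
    show "D (x * y) = x * D y + y * D x" for x y
    proof -
      have "to_fract (D (x * y)) = to_fract (x * D y + y * D x)"
        unfolding to_fract_simps(1,3) u(2)[symmetric] by (simp only: \<delta>(2) distrib_left mult_ac)
      thus ?thesis by (simp only: to_fract_simps(6))
    qed
    show "D c = 0" if "c \<in> k" for c
    proof -
      have "to_fract (D c) = to_fract 0"
        unfolding u(2)[symmetric] using that \<delta>(3)[OF kM] by (simp add: to_fract_simps)
      thus ?thesis by (simp only: to_fract_simps(6))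
    qed
  qed
  then obtain E where E: "HS_derivation k E" "E 1 = D" using int unfolding IDer_def by blast
  obtain \<Phi> where \<Phi>: "hs_hom ?k \<Phi>" "\<And>r n. fps_nth (\<Phi> (to_fract r)) n = to_fract (E n r)"
    using HS_derivation_hs_hom[OF k E(1)] by blast
  \<comment> \<open>As \<open>y\<close> need not lie in \<open>R\<close>, first-order terms are
    compared through \<open>y * b = a\<close> with \<open>a\<close> and \<open>b\<close> in
    \<open>R\<close>.\<close>
  obtain a b where ab: "b \<noteq> 0" "y * to_fract b = to_fract a" by (rule to_fract_quotient)
  have "\<Phi> (to_fract a) = fps_const y * \<Phi> (to_fract b)"
    using hs_homD(3)[OF \<Phi>(1) k', of y "to_fract b"] y(1) \<Phi>(1) unfolding ab(2) hs_fixed_def by auto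
  hence "to_fract (D a) = y * to_fract (D b)"
    using \<Phi>(2)[of a 1] \<Phi>(2)[of b 1] E(2) by simp
  hence "to_fract u * \<delta> (y * to_fract b) = to_fract u * (y * \<delta> (to_fract b))"
    unfolding u(2)[symmetric] ab(2)[symmetric] by (simp only: mult_ac)
  hence "to_fract u * to_fract b = 0" by (simp add: \<delta>(2) \<delta>_y distrib_left del: mult_fract)
  moreover have "to_fract u \<noteq> 0" "to_fract b \<noteq> 0" using u(1) ab(1) by (simp_all add: Zero_fract_def eq_fract)
  ultimately show False by (simp del: mult_fract)
qed

section \<open>Linear disjointness and independence\<close>

lemma tensor_relations_additive:
  fixes K S1 S2 :: "'a::comm_ring_1 set"
  defines "T \<equiv> tensor_relations K S1 S2"
  shows "f \<in> T \<Longrightarrow> g \<in> T \<Longrightarrow> f + g \<in> T" "f \<in> T \<Longrightarrow> g \<in> T \<Longrightarrow> f - g \<in> T" "0 \<in> T" "f \<in> T \<Longrightarrow> fscale n f \<in> T"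
    "(\<And>i. i \<in> I \<Longrightarrow> h i \<in> T) \<Longrightarrow> sum h I \<in> T"
  unfolding T_def tensor_relations_def
  by (auto intro: free.span_add free.span_diff free.span_zero free.span_scale free.span_sum)

lemma pure_tensor_relations:
  assumes "x \<in> S1" "y \<in> S2"
  shows "x' \<in> S1 \<Longrightarrow> pure_tensor (x + x') y - pure_tensor x y - pure_tensor x' y \<in> tensor_relations K S1 S2"
    "y' \<in> S2 \<Longrightarrow> pure_tensor x (y + y') - pure_tensor x y - pure_tensor x y' \<in> tensor_relations K S1 S2"
    "c \<in> K \<Longrightarrow> pure_tensor (x * c) y - pure_tensor x (c * y) \<in> tensor_relations K S1 S2"
  unfolding tensor_relations_def using assms by (auto intro!: free.span_base)

text \<open>Modulo the tensor relations, every tensor whose right factors lie in the span of \<open>C\<close> can be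
  written as \<open>\<Sum>c\<in>C. X c \<otimes> c\<close>; if \<open>C\<close> is independent over \<open>S\<^sub>1\<close>, its value determines the \<open>X c\<close>.\<close>

lemma tensor_normal_form:
  fixes K S1 k C :: "'a::comm_ring_1 set"
  assumes K: "is_subfield K" "K \<subseteq> S1" "K \<subseteq> k" and k: "is_subfield k"
    and S1: "0 \<in> S1" "\<And>x y. x \<in> S1 \<Longrightarrow> y \<in> S1 \<Longrightarrow> x + y \<in> S1" "\<And>x. x \<in> S1 \<Longrightarrow> - x \<in> S1"
      "\<And>x y. x \<in> S1 \<Longrightarrow> y \<in> S1 \<Longrightarrow> x * y \<in> S1"
    and C: "finite C" "C \<subseteq> k"
    and f: "f \<in> free_on (S1 \<times> (k \<inter> lspan K C))"
  shows "\<exists>X. (\<forall>c\<in>C. X c \<in> S1) \<and> f - (\<Sum>c\<in>C. pure_tensor (X c) c) \<in> tensor_relations K S1 k"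
proof -
  let ?T = "tensor_relations K S1 k"
  note T = tensor_relations_additive[where K = K and ?S1.0 = S1 and ?S2.0 = k]
  \<comment> \<open>The tensors that admit a normal form. \<open>H\<close> is shown to be a subgroup
    containing the pure tensors with left factor in \<open>S1\<close> and right factor in the span
    of \<open>C\<close>.\<close>
  define H where "H = {f. \<exists>X. (\<forall>c\<in>C. X c \<in> S1) \<and> f - (\<Sum>c\<in>C. pure_tensor (X c) c) \<in> ?T}"
  have CK: "c \<in> k" if "c \<in> C" for c using C(2) that by blast
  have zero: "pure_tensor 0 c \<in> ?T" if "c \<in> k" for c
    using T(2)[OF T(3) pure_tensor_relations(1)[OF S1(1) that S1(1), of K]] by simp
  have H0: "0 \<in> H"
    unfolding H_def using T(2)[OF T(3) T(5)[of C "\<lambda>c. pure_tensor 0 c"]] zero[OF CK] S1(1)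
    by (intro CollectI exI[of _ "\<lambda>_. 0"]) auto
  have H_add: "f + g \<in> H" if "f \<in> H" "g \<in> H" for f g
  proof -
    from that obtain X Y where X: "\<And>c. c \<in> C \<Longrightarrow> X c \<in> S1" "f - (\<Sum>c\<in>C. pure_tensor (X c) c) \<in> ?T"
      and Y: "\<And>c. c \<in> C \<Longrightarrow> Y c \<in> S1" "g - (\<Sum>c\<in>C. pure_tensor (Y c) c) \<in> ?T"
      unfolding H_def by blast
    have "(\<Sum>c\<in>C. pure_tensor (X c + Y c) c - pure_tensor (X c) c - pure_tensor (Y c) c) \<in> ?T"
      by (intro T(5) pure_tensor_relations X Y CK)
    from T(2)[OF T(1)[OF X(2) Y(2)] this]
    have "f + g - (\<Sum>c\<in>C. pure_tensor (X c + Y c) c) \<in> ?T"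
      by (simp add: sum_subtractf sum.distrib algebra_simps)
    thus ?thesis unfolding H_def using X Y S1(2)
      by (intro CollectI exI[of _ "\<lambda>c. X c + Y c"]) auto
  qed
  have H_neg: "- f \<in> H" if "f \<in> H" for f
  proof -
    from that obtain X where X: "\<And>c. c \<in> C \<Longrightarrow> X c \<in> S1" "f - (\<Sum>c\<in>C. pure_tensor (X c) c) \<in> ?T"
      unfolding H_def by blast
    have "(\<Sum>c\<in>C. pure_tensor (X c + - X c) c - pure_tensor (X c) c - pure_tensor (- X c) c) \<in> ?T"
      by (intro T(5) pure_tensor_relations X CK S1)
    moreover have "(\<Sum>c\<in>C. pure_tensor 0 c) \<in> ?T" by (intro T(5) zero CK)
    ultimately have "(\<Sum>c\<in>C. pure_tensor (X c + - X c) c - pure_tensor (X c) c - pure_tensor (- X c) c)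
        - (f - (\<Sum>c\<in>C. pure_tensor (X c) c)) - (\<Sum>c\<in>C. pure_tensor 0 c) \<in> ?T"
      by (intro T(2) X)
    hence "- f - (\<Sum>c\<in>C. pure_tensor (- X c) c) \<in> ?T"
      by (simp add: sum_subtractf sum.distrib algebra_simps)
    thus ?thesis unfolding H_def using X S1(3)
      by (intro CollectI exI[of _ "\<lambda>c. - X c"]) auto
  qed
  have H_scale_nat: "fscale (int m) f \<in> H" if "f \<in> H" for m f
  proof (induction m)
    case (Suc m)
    have "fscale (int (Suc m)) f = f + fscale (int m) f" by (simp add: free.scale_left_distrib)
    thus ?case using H_add[OF that Suc] by simp
  qed (simp add: H0)
  have H_scale: "fscale n f \<in> H" if "f \<in> H" for n f
    using H_scale_nat[OF that] H_neg[OF H_scale_nat[OF that]] by (cases n rule: int_cases2) auto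
  have H_T: "f \<in> H" if "f - g \<in> ?T" "g \<in> H" for f g
  proof -
    from that(2) obtain X where X: "\<forall>c\<in>C. X c \<in> S1" "g - (\<Sum>c\<in>C. pure_tensor (X c) c) \<in> ?T"
      unfolding H_def by blast
    with T(1)[OF that(1) X(2)] show ?thesis unfolding H_def by auto
  qed
  have pure: "pure_tensor x y \<in> H" if x: "x \<in> S1" and y: "y \<in> lspan K C" for x y
    using y
  proof induction
    case lspan_0
    have "pure_tensor x (0 + 0) - pure_tensor x 0 - pure_tensor x 0 \<in> ?T"
      using x is_subfieldD(1)[OF k] by (intro pure_tensor_relations)
    from T(2)[OF T(3) this] have "pure_tensor x 0 - 0 \<in> ?T" by simp
    thus ?case using H0 by (rule H_T)
  next
    case (lspan_step a c y)
    have "y \<in> k" using lspan_subset_subfield[OF k K(3) C(2)] lspan_step by blast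
    have ck: "c \<in> k" "a \<in> k" "a \<in> S1" using lspan_step K C(2) by auto
    have 1: "pure_tensor x (a * c + y) - pure_tensor x (a * c) - pure_tensor x y \<in> ?T"
      using x ck \<open>y \<in> k\<close> is_subfieldD(6)[OF k] by (intro pure_tensor_relations) auto
    have 2: "pure_tensor (x * a) c - pure_tensor x (a * c) \<in> ?T"
      using x ck lspan_step by (intro pure_tensor_relations) auto
    \<comment> \<open>The other left factors are 0, which is harmless because each
      \<open>0 \<otimes> d\<close> is a relation.\<close>
    have single: "pure_tensor z c \<in> H" if "z \<in> S1" for z
    proof -
      have "(\<Sum>d\<in>C - {c}. pure_tensor 0 d) \<in> ?T" by (intro T(5) zero) (use CK in auto)
      hence "pure_tensor z c - (\<Sum>d\<in>C. pure_tensor (if d = c then z else 0) d) \<in> ?T"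
        using T(2)[OF T(3)] lspan_step(2) C(1) by (simp add: sum.remove[of C c])
      thus ?thesis unfolding H_def using that S1(1)
        by (intro CollectI exI[of _ "\<lambda>d. if d = c then z else 0"]) auto
    qed
    \<comment> \<open>The scalar \<open>a \<in> K\<close> moves to the left factor, leaving a tensor
      with right factor in \<open>C\<close> and one covered by induction.\<close>
    have "pure_tensor x (a * c + y) - (pure_tensor (x * a) c + pure_tensor x y) \<in> ?T"
      using T(2)[OF 1 2] by (simp add: algebra_simps)
    moreover have "pure_tensor (x * a) c + pure_tensor x y \<in> H"
      using x ck S1(4) lspan_step by (intro H_add single) auto
    ultimately show ?case by (rule H_T)
  qed
  have f_eq: "f = (\<Sum>t\<in>Poly_Mapping.keys f. fscale (Poly_Mapping.lookup f t) (Poly_Mapping.single t 1))"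
    by (rule poly_mapping_eqI)
       (auto simp: lookup_sum lookup_single when_def in_keys_iff if_distrib cong: if_cong)
  have in_H: "(\<Sum>t\<in>A. fscale (Poly_Mapping.lookup f t) (Poly_Mapping.single t 1)) \<in> H"
    if "A \<subseteq> Poly_Mapping.keys f" "finite A" for A
    using that(2,1)
  proof (induction A rule: finite_induct)
    case (insert t A)
    hence "t \<in> S1 \<times> (k \<inter> lspan K C)" using f by (auto simp: free_on_def)
    hence "Poly_Mapping.single t 1 \<in> H" by (auto intro: pure)
    thus ?case using insert by (auto intro!: H_add H_scale)
  qed (simp add: H0)
  have "f \<in> H" using in_H[OF order_refl finite_keys] unfolding f_eq[symmetric] .
  thus ?thesis unfolding H_def by blast
qed

text \<open>It suffices that the kernel is trivial. A basis \<open>C\<close> over \<open>K\<close>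
  of the span of the right factors brings a tensor of value 0 into normal form; independence of
  \<open>C\<close> over \<open>S1\<close> then makes all left factors 0.\<close>

lemma linearly_disjoint_if_indep:
  fixes K S1 k :: "'a::comm_ring_1 set"
  assumes K: "is_subfield K" "K \<subseteq> S1" "K \<subseteq> k" and k: "is_subfield k"
    and S1: "0 \<in> S1" "\<And>x y. x \<in> S1 \<Longrightarrow> y \<in> S1 \<Longrightarrow> x + y \<in> S1" "\<And>x. x \<in> S1 \<Longrightarrow> - x \<in> S1"
      "\<And>x y. x \<in> S1 \<Longrightarrow> y \<in> S1 \<Longrightarrow> x * y \<in> S1"
    and indep: "\<And>C. finite C \<Longrightarrow> C \<subseteq> k \<Longrightarrow> \<not> lindep K C id \<Longrightarrow> \<not> lindep S1 C id"
  shows "linearly_disjoint K S1 k"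
proof -
  let ?T = "tensor_relations K S1 k"
  note T = tensor_relations_additive[where K = K and ?S1.0 = S1 and ?S2.0 = k]
  have zero: "f \<in> ?T" if f: "f \<in> free_on (S1 \<times> k)" "tensor_eval f = 0" for f
  proof -
    let ?Y = "snd ` Poly_Mapping.keys f"
    have Y: "finite ?Y" "?Y \<subseteq> k" using f(1) by (auto simp: free_on_def)
    obtain C where C: "C \<subseteq> ?Y" "finite C" "\<not> lindep K C id" "?Y \<subseteq> lspan K C"
      using basis_exists[OF K(1) Y(1), of ?Y] lspan_base[OF K(1)] by blast
    have Ck: "C \<subseteq> k" using C(1) Y(2) by blast
    have "f \<in> free_on (S1 \<times> (k \<inter> lspan K C))"
      using f(1) C(4) unfolding free_on_def by force
    then obtain X where X: "\<And>c. c \<in> C \<Longrightarrow> X c \<in> S1" "f - (\<Sum>c\<in>C. pure_tensor (X c) c) \<in> ?T"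
      using tensor_normal_form[OF K k S1 C(2) Ck] by blast
    have eval_sum: "tensor_eval (\<Sum>c\<in>J. pure_tensor (X c) c) = (\<Sum>c\<in>J. X c * c)" for J
      by (induction J rule: infinite_finite_induct) (simp_all add: tensor_eval_add tensor_eval_def[of 0])
    have "(\<Sum>c\<in>C. X c * c) = 0"
      using tensor_eval_relations[OF X(2)] f(2) by (simp add: tensor_eval_diff eval_sum)
    hence "(\<Sum>c\<in>C. (if c \<in> C then X c else 0) * id c) = 0" by simp
    moreover have "(if c \<in> C then X c else 0) \<in> S1" for c using X(1) S1(1) by simp
    ultimately have X0: "X c = 0" if "c \<in> C" for c
      using lindepD[OF indep[OF C(2) Ck C(3)], of "\<lambda>c. if c \<in> C then X c else 0" c] that by simp
    have "pure_tensor 0 c \<in> ?T" if "c \<in> k" for c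
      using T(2)[OF T(3) pure_tensor_relations(1)[OF S1(1) that S1(1), of K]] by simp
    hence "(\<Sum>c\<in>C. pure_tensor (X c) c) \<in> ?T" using X0 Ck by (intro T(5)) auto
    from T(1)[OF X(2) this] show ?thesis by simp
  qed
  have eq: "equiv UNIV (cong_mod ?T)"
    unfolding tensor_relations_def by (intro free.equiv_cong_mod free.subspace_span)
  show ?thesis
    unfolding linearly_disjoint_def tensor_product_def
  proof (rule inj_onI)
    fix A B assume "A \<in> free_on (S1 \<times> k) // cong_mod ?T" "B \<in> free_on (S1 \<times> k) // cong_mod ?T"
      and mult: "tensor_mult A = tensor_mult B"
    then obtain f g where f: "f \<in> free_on (S1 \<times> k)" "A = cong_mod ?T `` {f}"
      and g: "g \<in> free_on (S1 \<times> k)" "B = cong_mod ?T `` {g}"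
      unfolding quotient_def by blast
    have "f - g \<in> free_on (S1 \<times> k)"
      using f(1) g(1) keys_diff[of f g] unfolding free_on_def by blast
    moreover have "tensor_eval (f - g) = 0"
      using mult by (simp add: f(2) g(2) tensor_mult_class tensor_eval_diff)
    ultimately have "(f, g) \<in> cong_mod ?T" using zero by (simp add: cong_mod_def)
    thus "A = B" unfolding f(2) g(2) by (rule equiv_class_eq[OF eq])
  qed
qed

section \<open>Transfer of relations between \<open>R\<close> and \<open>Q(R)\<close>, and the
  conclusion\<close>

lemma lindep_to_fract:
  fixes S C :: "'a::idom set"
  shows "lindep (to_fract ` S) (to_fract ` C) id \<longleftrightarrow> lindep S C id"
proof
  have inj: "inj_on to_fract C" by (rule inj_onI) (simp only: to_fract_simps(6))
  assume "lindep S C id"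
  then obtain f i where f: "\<And>c. f c \<in> S" "i \<in> C" "f i \<noteq> 0" "(\<Sum>c\<in>C. f c * c) = 0"
    unfolding lindep_def by auto
  define g where "g x = to_fract (f (inv_into C to_fract x))" for x
  have g: "g (to_fract c) = to_fract (f c)" if "c \<in> C" for c
    using that by (simp add: g_def inv_into_f_f[OF inj])
  have "(\<Sum>x\<in>to_fract ` C. g x * id x) = (\<Sum>c\<in>C. to_fract (f c * c))"
    by (simp add: sum.reindex[OF inj] g to_fract_simps(3) del: mult_fract)
  also have "\<dots> = 0" unfolding to_fract_simps(8)[symmetric] f(4) by (rule to_fract_simps)
  finally have "(\<Sum>x\<in>to_fract ` C. g x * id x) = 0" .
  moreover have "g (to_fract i) \<noteq> 0"
    using f(3) by (simp add: g[OF f(2)] Zero_fract_def eq_fract)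
  moreover have "g x \<in> to_fract ` S" for x using f(1) by (simp add: g_def)
  ultimately show "lindep (to_fract ` S) (to_fract ` C) id"
    unfolding lindep_def using f(2) by blast
next
  have inj: "inj_on to_fract C" by (rule inj_onI) (simp only: to_fract_simps(6))
  assume "lindep (to_fract ` S) (to_fract ` C) id"
  then obtain g i where g: "\<And>x. g x \<in> to_fract ` S" "i \<in> C" "g (to_fract i) \<noteq> 0" "(\<Sum>x\<in>to_fract ` C. g x * x) = 0"
    unfolding lindep_def by auto
  have "\<forall>c. \<exists>s\<in>S. g (to_fract c) = to_fract s" using g(1) by blast
  then obtain f where f: "\<And>c. f c \<in> S" "\<And>c. g (to_fract c) = to_fract (f c)" by metis
  have "to_fract (\<Sum>c\<in>C. f c * c) = (\<Sum>x\<in>to_fract ` C. g x * x)"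
    unfolding sum.reindex[OF inj] to_fract_simps(3,8) by (simp only: o_def f(2))
  also have "\<dots> = to_fract 0" unfolding g(4) by (simp only: to_fract_simps)
  finally have "(\<Sum>c\<in>C. f c * id c) = 0" by (simp only: to_fract_simps(6) id_apply)
  moreover have "f i \<noteq> 0" using g(3) by (auto simp: f(2) to_fract_simps)
  ultimately show "lindep S C id" unfolding lindep_def using f(1) g(2) by blast
qed

theorem theorem4p5:
  fixes k :: "'a::idom set" and p :: nat
  assumes "is_subfield k"
    and "CHAR('a) = p" and "p > 0"
    and "\<not> linearly_disjoint ((\<lambda>c. c ^ p) ` k) (range (\<lambda>r::'a. r ^ p)) k"
    and "kaehler_finitely_presented k"
    and "fraction_field_finitely_generated k"
  shows "IDer k \<subset> Der k"
proof (rule psubsetI)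
  show "IDer k \<subseteq> Der k" unfolding IDer_def by blast
  note k = assms(1)
  have p: "prime CHAR('a)" using assms(2,3) prime_CHAR_semidom by blast
  let ?p = "CHAR('a)" and ?k = "to_fract ` k"
  show "IDer k \<noteq> Der k"
  proof
    assume "IDer k = Der k"
    hence small: "hs_fixed ?k \<subseteq> powspan ?k ?p UNIV"
      by (intro hs_fixed_subset_powspan k p assms(5)) simp
    obtain S where S: "finite S" "field_generated (?k \<union> S) = UNIV"
      using assms(6) unfolding fraction_field_finitely_generated_def by blast
    have p': "prime CHAR('a fract)" using p by (simp add: CHAR_fract)
    have p0: "?p > 0" using p by (rule prime_gt_0_nat)
    note dream = freshmans_dream[OF p refl]
    let ?K = "(\<lambda>c. c ^ ?p) ` k" and ?R = "range (\<lambda>r::'a. r ^ ?p)"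
    have K: "is_subfield ?K" by (rule is_subfield_power_image[OF k p])
    \<comment> \<open>Independence over \<open>k^p\<close> is moved to \<open>Q(R)\<close>,
      strengthened there to independence over all \<open>p\<close>-th powers, in particular over
      those from \<open>R\<close>, and moved back.\<close>
    have "\<not> lindep ?R C id" if C: "finite C" "C \<subseteq> k" "\<not> lindep ?K C id" for C
    proof -
      have "(\<lambda>c. c ^ ?p) ` ?k = to_fract ` ?K"
        unfolding image_image to_fract_simps(7) ..
      hence "\<not> lindep ((\<lambda>c. c ^ ?p) ` ?k) (to_fract ` C) id"
        using C(3) by (simp only: lindep_to_fract not_False_eq_True)
      hence "\<not> lindep (range (\<lambda>x::'a fract. x ^ ?p)) (to_fract ` C) id"
        using indep_powers_if_hs_fixed_small[OF is_subfield_to_fract[OF k] p' S _ _ image_mono[OF C(2)]] C(1) small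
        unfolding CHAR_fract by blast
      moreover have "to_fract ` ?R \<subseteq> range (\<lambda>x::'a fract. x ^ ?p)"
        unfolding image_image to_fract_simps(7) by blast
      moreover have "is_subfield (range (\<lambda>x::'a fract. x ^ ?p))"
        using is_subfield_power_image[OF is_subfield_UNIV p'] unfolding CHAR_fract .
      ultimately have "\<not> lindep (to_fract ` ?R) (to_fract ` C) id"
        using lindep_mono[OF _ _ _ order_refl, of _ "to_fract ` ?R" "to_fract ` C" id] C(1) by blast
      thus ?thesis unfolding lindep_to_fract .
    qed
    hence "linearly_disjoint ?K ?R k"
    proof (rule linearly_disjoint_if_indep[OF K, rotated -1])
      show "?K \<subseteq> k" using is_subfieldD(7)[OF k] by blast
      show "0 \<in> ?R" by (intro range_eqI[of _ _ 0]) (simp add: p0)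
      fix x assume "x \<in> ?R"
      then obtain a where a: "x = a ^ ?p" by blast
      have "- (a ^ ?p) = (- a) ^ ?p" by (simp add: minus_power_prime_CHAR[OF refl p])
      thus "- x \<in> ?R" unfolding a by simp
      fix y assume "y \<in> ?R"
      then obtain b where b: "y = b ^ ?p" by blast
      show "x + y \<in> ?R" unfolding a b dream[symmetric] by simp
      show "x * y \<in> ?R" unfolding a b power_mult_distrib[symmetric] by simp
    qed (use k in auto)
    with assms(2,4) show False by simp
  qed
qed

end
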